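(* Let $\xi<0$ and let $(X_n,n\ge 1)$ be i.i.d. random variables with distribution function $F$ which has a finite right end point $x_F$ and satisfies $1-F(x_F-x^{-1})\in RV_{1/\xi}$ as $x\to\infty$. Let $k=k_n$ be a sequence of positive integers with $k_n\to\infty$ and $k_n/n\to 0$ as $n\to\infty$. For each $n$ let $X_{(1)}\ge X_{(2)}\ge\cdots\ge X_{(n)}$ be the order statistics of $X_1,\dots,X_n$ and let $\hat M$ be the empirical mean excess function of $X_1,\dots,X_n$. Then, as $n\to\infty$, $$\mathcal{S}_n:=\frac{1}{X_{(1)}-X_{(k)}}\Big\{\big(X_{(i)}-X_{(k)},\,\hat M(X_{(i)})\big):1<i\le k\Big\}\ \stackrel{P}{\longrightarrow}\ \mathcal{S}:=\Big\{\Big(t,\frac{\xi}{1-\xi}(t-1)\Big):0\le t\le 1\Big\}$$ in $\mathcal{F}$, the space of closed subsets of $\mathbb{R}^2$ with the Fell topology.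
   Context: The right end point of $F$ is $x_F=\sup\{x:F(x)<1\}$. A function $U:(0,\infty)\to\mathbb{R}_+$ is regularly varying with index $\rho\in\mathbb{R}$, written $U\in RV_\rho$, if $\lim_{t\to\infty}U(tx)/U(t)=x^\rho$ for all $x>0$; here this is applied to $U(x)=1-F(x_F-x^{-1})$. The empirical mean excess function of the sample $X_1,\dots,X_n$ is $$\hat M(u)=\frac{\sum_{j=1}^n (X_j-u)I_{[X_j>u]}}{\sum_{j=1}^n I_{[X_j>u]}},$$ with the value $0$ when the denominator is $0$. It depends on $n$. For a real number $x$ and a set $A\subset\mathbb{R}^2$, $xA=\{xy:y\in A\}$. $\mathcal{F}$ denotes the collection of closed subsets of $\mathbb{R}^2$ with the Fell topology, generated by the families $\{F\in\mathcal{F}:F\cap K=\emptyset\}$ ($K$ compact) and $\{F\in\mathcal{F}:F\cap G\ne\emptyset\}$ ($G$ open). This topology is metrizable, and $\stackrel{P}{\longrightarrow}$ in $\mathcal{F}$ denotes convergence in probability of random closed sets with respect to such a metric. Equivalently, every subsequence has a further subsequence along which the sets converge almost surely in the Fell topology. *)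

theory Defs
  imports "HOL-Probability.Probability"
begin

definition right_endpoint :: "(real \<Rightarrow> real) \<Rightarrow> ereal" where
  "right_endpoint F = (SUP x\<in>{x. F x < 1}. ereal x)"

text \<open>Only the values on the positive half-line matter; there the function is nonnegative.\<close>

definition regularly_varying :: "(real \<Rightarrow> real) \<Rightarrow> real \<Rightarrow> bool" where
  "regularly_varying U \<rho> \<longleftrightarrow>
     (\<forall>t>0. 0 \<le> U t) \<and>
     (\<forall>x>0. ((\<lambda>t. U (t * x) / U t) \<longlongrightarrow> x powr \<rho>) at_top)"

text \<open>The \<open>i\<close>-th largest of \<open>x 1, \<dots>, x n\<close>, meaningful for \<open>1 \<le> i \<le> n\<close>.\<close>

definition order_stat :: "(nat \<Rightarrow> real) \<Rightarrow> nat \<Rightarrow> nat \<Rightarrow> real" where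
  "order_stat x n i = rev (sort (map x [1..<Suc n])) ! (i - 1)"

text \<open>The value is \<open>0\<close> when no observation exceeds \<open>u\<close>, because division by \<open>0\<close> yields \<open>0\<close>.\<close>

definition emp_mean_excess :: "(nat \<Rightarrow> real) \<Rightarrow> nat \<Rightarrow> real \<Rightarrow> real" where
  "emp_mean_excess x n u =
     (\<Sum>j=1..n. (x j - u) * of_bool (x j > u)) / (\<Sum>j=1..n. of_bool (x j > u))"

definition me_plot_set :: "(nat \<Rightarrow> real) \<Rightarrow> nat \<Rightarrow> nat \<Rightarrow> (real \<times> real) set" where
  "me_plot_set x n k =
     (\<lambda>p. (1 / (order_stat x n 1 - order_stat x n k)) *\<^sub>R p) `
       {(order_stat x n i - order_stat x n k, emp_mean_excess x n (order_stat x n i)) | i.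
          1 < i \<and> i \<le> k}"

definition fell_topology :: "'a::topological_space set topology" where
  "fell_topology = topology_generated_by
     ({{F. closed F \<and> F \<inter> K = {}} | K. compact K} \<union>
      {{F. closed F \<and> F \<inter> G \<noteq> {}} | G. open G})"

lemma topspace_fell_topology: "topspace fell_topology = Collect closed"
  unfolding fell_topology_def topology_generated_by_topspace
proof (rule equalityI)
  show "Collect closed \<subseteq> \<Union>({{F :: 'a set. closed F \<and> F \<inter> K = {}} | K. compact K} \<union>
          {{F. closed F \<and> F \<inter> G \<noteq> {}} | G. open G})"
    by (rule Union_upper, rule UnI1, rule CollectI, rule exI[of _ "{}"], simp)
qed auto

text \<open>
  Convergence in probability of random elements of a metrizable space to a constant. The
  statement does not depend on which compatible metric is chosen. Measurability (with respect
  to the Borel sigma-algebra) is part of the notion, as \<^const>\<open>measure\<close> assigns \<open>0\<close> to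
  non-measurable sets; it also forces the values to lie in \<^term>\<open>topspace T\<close>. It is required for
  large \<open>n\<close> only, since the first few terms of a sequence may fail to be meaningful.
\<close>

definition conv_in_prob ::
  "'w measure \<Rightarrow> 'b topology \<Rightarrow> (nat \<Rightarrow> 'w \<Rightarrow> 'b) \<Rightarrow> 'b \<Rightarrow> bool" where
  "conv_in_prob M T Y L \<longleftrightarrow>
     L \<in> topspace T \<and>
     (\<forall>\<^sub>F n in sequentially. Y n \<in> measurable M (sigma (topspace T) {U. openin T U})) \<and>
     (\<exists>d. Metric_space (topspace T) d \<and> Metric_space.mtopology (topspace T) d = T \<and>
        (\<forall>\<epsilon>>0. (\<lambda>n. measure M {\<omega> \<in> space M. d (Y n \<omega>) L > \<epsilon>}) \<longlonglongrightarrow> 0))"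

end

theory Submission
  imports Defs
begin

text \<open>
  Put \<open>a = - 1 / \<xi> > 0\<close> and \<open>G s = 1 - F (xF - s)\<close>, which is regularly varying with index \<open>a\<close>
  at \<open>0\<close>. The plot is invariant under affine changes of scale, so it may be drawn for the
  rescaled distances \<open>D\<^sub>j = (xF - X\<^sub>j) / s\<^sub>n\<close> to the end point, where \<open>s\<^sub>n\<close> is the level at which
  \<open>G\<close> reaches \<open>k\<^sub>n / n\<close>. With this choice \<open>n G (s\<^sub>n y) / k\<^sub>n\<close> tends to \<open>y\<^sup>a\<close> for every \<open>y > 0\<close>
  (\<open>regularly_varying_threshold\<close>), and since the variance of a binomial count is at most its
  mean, the Chebyshev inequality shows that the normalised count
  \<open>\<nu>\<^sub>n y = #{j \<le> n. D\<^sub>j < y} / k\<^sub>n\<close> converges to \<open>y\<^sup>a\<close> in probability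
  (\<open>count_ratio_tendsto_high_prob\<close>). Apart from the fact that almost surely no observation
  exceeds \<open>xF\<close>, this is the only probabilistic input.

  The shape of the plot is a deterministic consequence of that convergence. The functions
  \<open>\<nu>\<^sub>n\<close> are monotone and the limit is continuous, so the convergence is uniform on
  bounded intervals. In the new scale
  the mean excess over the level at distance \<open>y\<close> equals \<open>(\<integral>\<^sub>0\<^sup>y \<nu>\<^sub>n) / \<nu>\<^sub>n y\<close>, whose limit is
  \<open>y / (a + 1)\<close>, again uniformly down to \<open>y = 0\<close> (\<open>mean_excess_uniform_limit\<close>). This form
  involves no sorting and is insensitive to ties in the sample. The distances of the order
  statistics invert the count: the \<open>l\<close>-th smallest distance is below \<open>y\<close> exactly when at least \<open>l\<close>
  distances are. Hence the smallest one tends to \<open>0\<close>, the \<open>k\<^sub>n\<close>-th one to \<open>1\<close>, and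
  those in between fill \<open>[0, 1]\<close>. A point of the plot with distance \<open>y\<close> is therefore close to
  \<open>(1 - y, y / (a + 1))\<close>, which is the point of the limiting segment with abscissa \<open>t = 1 - y\<close>,
  because \<open>1 / (a + 1) = - \<xi> / (1 - \<xi>)\<close>.

  To carry out these limit arguments in probability as if they were ordinary ones, the events of
  probability tending to \<open>1\<close> are regarded as a filter, \<open>high_prob\<close>; the
  locale \<open>top_order_array\<close> works along an arbitrary filter. Two facts about the Fell topology
  finish the proof: it is metrizable (\<open>fell_topology_metric\<close>), so that convergence in
  probability only has to be tested on the subbasic neighbourhoods of the limit, and a finite set
  depends continuously on an enumeration of its points, which gives measurability.
\<close>

section \<open>Metrizability of the Fell topology\<close>

text \<open>For a dense sequence \<open>q\<close>, a closed set is determined by its distances from the points \<open>q n\<close>. The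
  exponential turns them into numbers in \<open>[0, 1]\<close> for which the empty set, at infinite
  distance, corresponds to the value \<open>0\<close>; this makes \<open>proximity q\<close> an embedding of all closed
  sets, the empty one included, into the metrizable space of real sequences.\<close>

definition proximity :: "(nat \<Rightarrow> 'a::metric_space) \<Rightarrow> 'a set \<Rightarrow> nat \<Rightarrow> real" where
  "proximity q A n = (if A = {} then 0 else exp (- infdist (q n) A))"

lemma infdist_less_iff_ball:
  "A \<noteq> {} \<Longrightarrow> infdist x A < r \<longleftrightarrow> A \<inter> ball x r \<noteq> {}"
  by (auto simp: infdist_def cINF_less_iff)

lemma infdist_le_iff_cball:
  fixes x :: "'a::heine_borel"
  assumes "closed A" "A \<noteq> {}"
  shows "infdist x A \<le> r \<longleftrightarrow> A \<inter> cball x r \<noteq> {}"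
proof -
  obtain y where y: "y \<in> A" "\<And>z. z \<in> A \<Longrightarrow> dist x y \<le> dist x z"
    using distance_attains_inf[OF assms] by blast
  have "dist x y \<le> infdist x A"
    unfolding infdist_def using y assms by (auto intro!: cINF_greatest)
  then show ?thesis
    using y(1) by (auto intro: infdist_le2)
qed

text \<open>The next two equivalences translate strict bounds on one coordinate of the embedding into the two
  kinds of subbasic Fell-open sets: sets that hit an open ball, and sets that miss
  a compact ball. The second one needs bounded closed sets to be compact, so that the distance is
  attained.\<close>

lemma proximity_gt_iff:
  "proximity q A n > exp (- r) \<longleftrightarrow> A \<inter> ball (q n) r \<noteq> {}"
  by (cases "A = {}") (simp_all add: proximity_def less_imp_not_less flip: infdist_less_iff_ball)

lemma proximity_less_iff:
  fixes q :: "nat \<Rightarrow> 'a::heine_borel"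
  assumes "closed A"
  shows "proximity q A n < exp (- r) \<longleftrightarrow> A \<inter> cball (q n) r = {}"
proof (cases "A = {}")
  case False
  then show ?thesis
    using infdist_le_iff_cball[OF assms False, of "q n" r] by (simp add: proximity_def not_le) linarith
qed (simp add: proximity_def)

lemma ex_dense_sequence:
  obtains q :: "nat \<Rightarrow> 'a::second_countable_topology"
  where "\<And>U. open U \<Longrightarrow> U \<noteq> {} \<Longrightarrow> \<exists>n. q n \<in> U"
proof -
  obtain D :: "'a set" where D: "countable D" "\<And>X. open X \<Longrightarrow> X \<noteq> {} \<Longrightarrow> \<exists>d\<in>D. d \<in> X"
    using countable_dense_setE by blast
  have "D \<noteq> {}" using D(2)[of UNIV] by auto
  show thesis
  proof (rule that[of "from_nat_into D"])
    fix U :: "'a set" assume "open U" "U \<noteq> {}"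
    then obtain d where "d \<in> D" "d \<in> U" using D(2) by blast
    then show "\<exists>n. from_nat_into D n \<in> U"
      using from_nat_into_to_nat_on[OF D(1)] by metis
  qed
qed

lemma dense_sequence_ball:
  fixes q :: "nat \<Rightarrow> 'a::metric_space"
  assumes dense: "\<And>U. open U \<Longrightarrow> U \<noteq> {} \<Longrightarrow> \<exists>n. q n \<in> U"
    and "open G" "a \<in> G"
  obtains n r where "r > 0" "a \<in> ball (q n) r" "cball (q n) r \<subseteq> G"
proof -
  obtain e where e: "e > 0" "ball a e \<subseteq> G"
    using assms(2,3) open_contains_ball by blast
  obtain n where n: "q n \<in> ball a (e / 3)"
    using dense[of "ball a (e / 3)"] e(1) by auto
  have "cball (q n) (e / 3) \<subseteq> ball a e"
  proof
    fix y assume "y \<in> cball (q n) (e / 3)"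
    then show "y \<in> ball a e"
      using n dist_triangle[of a y "q n"] e(1) by simp
  qed
  then show thesis
    using that[of "e / 3" n] e n by (auto simp: dist_commute)
qed

lemma openin_fell_miss: "compact K \<Longrightarrow> openin fell_topology {A. closed A \<and> A \<inter> K = {}}"
  unfolding fell_topology_def by (rule topology_generated_by_Basis) blast

lemma openin_fell_hit: "open G \<Longrightarrow> openin fell_topology {A. closed A \<and> A \<inter> G \<noteq> {}}"
  unfolding fell_topology_def by (rule topology_generated_by_Basis) blast

text \<open>A real function is continuous if its strict upper and lower level sets are open, and these are
  subbasic (or trivial) by the two equivalences above.\<close>

lemma continuous_map_proximity:
  fixes q :: "nat \<Rightarrow> 'a::heine_borel"
  shows "continuous_map fell_topology euclidean (proximity q)"
proof -
  have "continuous_map fell_topology euclideanreal (\<lambda>A. proximity q A n)" for n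
    unfolding continuous_map_upper_lower_semicontinuous_lt topspace_fell_topology
  proof safe
    fix c :: real
    show "openin fell_topology {A \<in> Collect closed. c < proximity q A n}"
    proof (cases "c \<ge> 0")
      case c0: True
      show ?thesis
      proof (cases "c = 0")
        case True
        have "{A \<in> Collect closed. c < proximity q A n} = {A. closed A \<and> A \<inter> UNIV \<noteq> {}}"
          using True by (auto simp: proximity_def)
        then show ?thesis using openin_fell_hit[of UNIV] by auto
      next
        case False
        have "{A \<in> Collect closed. c < proximity q A n}
            = {A. closed A \<and> A \<inter> ball (q n) (- ln c) \<noteq> {}}"
          using proximity_gt_iff[of "- ln c" q _ n] False c0 by auto
        then show ?thesis using openin_fell_hit[of "ball (q n) (- ln c)"] by simp
      qed
    next
      case False
      then have "c < proximity q A n" for A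
        by (smt (verit) proximity_def exp_gt_zero)
      then have "{A \<in> Collect closed. c < proximity q A n} = topspace fell_topology"
        by (auto simp: topspace_fell_topology)
      then show ?thesis by simp
    qed
    show "openin fell_topology {A \<in> Collect closed. proximity q A n < c}"
    proof (cases "c > 0")
      case True
      have "{A \<in> Collect closed. proximity q A n < c}
          = {A. closed A \<and> A \<inter> cball (q n) (- ln c) = {}}"
        using proximity_less_iff[of _ q n "- ln c"] True by auto
      then show ?thesis using openin_fell_miss[of "cball (q n) (- ln c)"] by simp
    next
      case False
      have "0 \<le> proximity q A n" for A by (simp add: proximity_def)
      then have "{A \<in> Collect closed. proximity q A n < c} = {}"
        using False by (smt (verit) Collect_empty_eq)
      then show ?thesis by (simp only: openin_empty)
    qed
  qed
  then show ?thesis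
    using continuous_map_componentwise_UNIV[of fell_topology "\<lambda>_. euclideanreal" "proximity q"]
    by (simp add: euclidean_product_topology)
qed

text \<open>This lemma and the next one give the converse continuity: membership in a subbasic
  Fell-open set follows from finitely many strict inequalities for coordinates.\<close>

lemma hit_open_nbhd:
  fixes q :: "nat \<Rightarrow> 'a::heine_borel"
  assumes dense: "\<And>U. open U \<Longrightarrow> U \<noteq> {} \<Longrightarrow> \<exists>n. q n \<in> U"
    and "open G" "A \<inter> G \<noteq> {}"
  obtains W where "open W" "proximity q A \<in> W" "\<And>B. proximity q B \<in> W \<Longrightarrow> B \<inter> G \<noteq> {}"
proof -
  obtain a where a: "a \<in> A" "a \<in> G" using assms(3) by blast
  obtain n r where nr: "r > 0" "a \<in> ball (q n) r" "cball (q n) r \<subseteq> G"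
    by (rule dense_sequence_ball[OF dense assms(2) a(2)])
  show thesis
  proof (rule that[of "{f. exp (- r) < f n}"])
    show "open {f :: nat \<Rightarrow> real. exp (- r) < f n}"
      by (intro open_Collect_less continuous_intros) auto
    show "proximity q A \<in> {f. exp (- r) < f n}"
      using a(1) nr(2) by (auto simp: proximity_gt_iff)
    show "B \<inter> G \<noteq> {}" if B: "proximity q B \<in> {f. exp (- r) < f n}" for B
    proof -
      have "B \<inter> ball (q n) r \<noteq> {}" using B by (simp add: proximity_gt_iff)
      moreover have "ball (q n) r \<subseteq> G" using nr(3) ball_subset_cball by (rule order_trans[rotated])
      ultimately show ?thesis by blast
    qed
  qed
qed

text \<open>By compactness \<open>K\<close> is covered by finitely many open balls around points of the dense sequence
  whose closed balls miss \<open>A\<close>; it suffices to miss those.\<close>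

lemma miss_open_nbhd:
  fixes q :: "nat \<Rightarrow> 'a::heine_borel"
  assumes dense: "\<And>U. open U \<Longrightarrow> U \<noteq> {} \<Longrightarrow> \<exists>n. q n \<in> U"
    and "compact K" "closed A" "A \<inter> K = {}"
  obtains W where "open W" "proximity q A \<in> W"
    "\<And>B. closed B \<Longrightarrow> proximity q B \<in> W \<Longrightarrow> B \<inter> K = {}"
proof -
  define C where "C = {(n, r). cball (q n) r \<inter> A = {}}"
  have "K \<subseteq> (\<Union>(n, r)\<in>C. ball (q n) r)"
  proof
    fix a assume "a \<in> K"
    then have "a \<in> - A" using assms(4) by blast
    then obtain n r where "a \<in> ball (q n) r" "cball (q n) r \<subseteq> - A"
      using dense_sequence_ball[OF dense open_Compl[OF assms(3)]] by blast
    then show "a \<in> (\<Union>(n, r)\<in>C. ball (q n) r)"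
      unfolding C_def by blast
  qed
  then obtain C' where C': "C' \<subseteq> C" "finite C'" "K \<subseteq> (\<Union>(n, r)\<in>C'. ball (q n) r)"
    by (rule compactE_image[OF assms(2), rotated]) auto
  define W where "W = (\<Inter>(n, r)\<in>C'. {f :: nat \<Rightarrow> real. f n < exp (- r)})"
  show thesis
  proof (rule that[of W])
    show "open W" unfolding W_def
      by (intro open_INT C'(2)) (auto intro!: open_Collect_less continuous_intros)
    show "proximity q A \<in> W"
      using C'(1) by (fastforce simp: W_def C_def proximity_less_iff[OF assms(3)])
    show "B \<inter> K = {}" if B: "closed B" "proximity q B \<in> W" for B
    proof -
      have "B \<inter> cball (q n) r = {}" if "(n, r) \<in> C'" for n r
        using B(2) that by (auto simp: W_def simp flip: proximity_less_iff[OF B(1)])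
      then show ?thesis
        using C'(3) ball_subset_cball by fastforce
    qed
  qed
qed

lemma fell_topology_metric:
  obtains d :: "'a::{heine_borel,second_countable_topology} set \<Rightarrow> 'a set \<Rightarrow> real"
  where "Metric_space (Collect closed) d"
    "Metric_space.mtopology (Collect closed) d = fell_topology"
proof -
  obtain q :: "nat \<Rightarrow> 'a" where dense: "\<And>U. open U \<Longrightarrow> U \<noteq> {} \<Longrightarrow> \<exists>n. q n \<in> U"
    using ex_dense_sequence by blast
  define d where "d A B = dist (proximity q A) (proximity q B)" for A B
  have inj: "A \<subseteq> B" if B: "closed B" "proximity q A = proximity q B" for A B
  proof (rule ccontr)
    assume "\<not> A \<subseteq> B"
    then have "A \<inter> - B \<noteq> {}" by blast
    then obtain W where "proximity q A \<in> W" "\<And>B'. proximity q B' \<in> W \<Longrightarrow> B' \<inter> - B \<noteq> {}"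
      using hit_open_nbhd[OF dense open_Compl[OF B(1)]] by metis
    then have "B \<inter> - B \<noteq> {}" using B(2) by metis
    then show False by simp
  qed
  interpret Metric_space "Collect closed" d
  proof
    show "d A B = 0 \<longleftrightarrow> A = B" if "A \<in> Collect closed" "B \<in> Collect closed" for A B
      using inj[of A B] inj[of B A] that by (auto simp: d_def)
  qed (simp_all add: d_def dist_commute dist_triangle)
  have pullback: "openin mtopology U"
    if sub: "U \<subseteq> Collect closed"
      and ex: "\<And>A. A \<in> U \<Longrightarrow> \<exists>W. open W \<and> proximity q A \<in> W \<and>
             (\<forall>B. closed B \<longrightarrow> proximity q B \<in> W \<longrightarrow> B \<in> U)" for U
    unfolding openin_mtopology
  proof (intro conjI allI impI sub)
    fix A assume "A \<in> U"
    then obtain W where W: "open W" "proximity q A \<in> W"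
      "\<And>B. closed B \<Longrightarrow> proximity q B \<in> W \<Longrightarrow> B \<in> U"
      using ex[of A] by blast
    from W(1,2) obtain r where "r > 0" "ball (proximity q A) r \<subseteq> W"
      by (rule openE)
    then show "\<exists>r>0. mball A r \<subseteq> U"
      using W(3) by (intro exI[of _ r]) (auto simp: d_def subset_iff)
  qed
  have "continuous_map mtopology fell_topology id"
    unfolding fell_topology_def
  proof (rule continuous_on_generated_topo)
    fix U :: "'a set set"
    assume "U \<in> {{F. closed F \<and> F \<inter> K = {}} | K. compact K} \<union>
      {{F. closed F \<and> F \<inter> G \<noteq> {}} | G. open G}"
    then consider K where "compact K" "U = {F. closed F \<and> F \<inter> K = {}}"
      | G where "open G" "U = {F. closed F \<and> F \<inter> G \<noteq> {}}"
      by blast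
    then have "openin mtopology U"
    proof cases
      case 1
      show ?thesis
      proof (rule pullback)
        fix A assume "A \<in> U"
        then have "closed A" "A \<inter> K = {}" using 1 by auto
        then show "\<exists>W. open W \<and> proximity q A \<in> W \<and>
            (\<forall>B. closed B \<longrightarrow> proximity q B \<in> W \<longrightarrow> B \<in> U)"
          using miss_open_nbhd[OF dense 1(1), of A] 1(2) by (metis (mono_tags, lifting) CollectI)
      qed (use 1 in auto)
    next
      case 2
      show ?thesis
      proof (rule pullback)
        fix A assume "A \<in> U"
        then have "A \<inter> G \<noteq> {}" using 2 by auto
        then show "\<exists>W. open W \<and> proximity q A \<in> W \<and>
            (\<forall>B. closed B \<longrightarrow> proximity q B \<in> W \<longrightarrow> B \<in> U)"
          using hit_open_nbhd[OF dense 2(1), of A] 2(2) by (metis (mono_tags, lifting) CollectI)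
      qed (use 2 in auto)
    qed
    moreover have "id -` U \<inter> topspace mtopology = U"
      using \<open>openin mtopology U\<close> openin_subset by fastforce
    ultimately show "openin mtopology (id -` U \<inter> topspace mtopology)" by simp
  next
    show "id ` topspace mtopology \<subseteq> \<Union> ({{F. closed F \<and> F \<inter> K = {}} | K. compact K} \<union>
      {{F. closed F \<and> F \<inter> G \<noteq> {}} | G :: 'a set. open G})"
      using topspace_fell_topology[where 'a = 'a]
      unfolding fell_topology_def topology_generated_by_topspace by simp
  qed
  then have 1: "openin mtopology U" if "openin fell_topology U" for U
  proof -
    have "openin mtopology {A \<in> topspace mtopology. id A \<in> U}"
      using openin_continuous_map_preimage[OF \<open>continuous_map mtopology fell_topology id\<close> that] .
    moreover have "{A \<in> topspace mtopology. id A \<in> U} = U"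
      using openin_subset[OF that] by (auto simp: topspace_fell_topology)
    ultimately show ?thesis by simp
  qed
  have ball: "openin fell_topology (mball A r)" if "closed A" for A r
  proof -
    have "mball A r = {B \<in> topspace fell_topology. proximity q B \<in> ball (proximity q A) r}"
      using that by (auto simp: d_def topspace_fell_topology)
    then show ?thesis
      using openin_continuous_map_preimage[OF continuous_map_proximity, of "ball (proximity q A) r"]
      by simp
  qed
  have 2: "openin fell_topology U" if "openin mtopology U" for U
  proof (subst openin_subopen, intro ballI)
    fix A assume A: "A \<in> U"
    have U: "U \<subseteq> Collect closed" "\<forall>A. A \<in> U \<longrightarrow> (\<exists>r>0. mball A r \<subseteq> U)"
      using that by (simp_all add: openin_mtopology)
    then obtain r where r: "r > 0" "mball A r \<subseteq> U"
      using A by metis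
    have "closed A" using U(1) A by blast
    then show "\<exists>T. openin fell_topology T \<and> A \<in> T \<and> T \<subseteq> U"
      using ball[of A r] r by (intro exI[of _ "mball A r"]) simp
  qed
  have "mtopology = fell_topology"
    unfolding topology_eq using 1 2 by metis
  then show thesis
    using that[of d] Metric_space_axioms by simp
qed

section \<open>Random finite sets\<close>

text \<open>To hit an open set is a finite union, and to miss a closed one a finite intersection, of open
  conditions on single points. This gives measurability of random finite sets without any
  description of the Borel sets of the Fell topology.\<close>

lemma continuous_map_finite_set:
  assumes "finite I"
  shows "continuous_map euclidean fell_topology (\<lambda>p :: 'i \<Rightarrow> 'a::t2_space. p ` I)"
  unfolding fell_topology_def
proof (rule continuous_on_generated_topo)
  fix U :: "'a set set"
  assume "U \<in> {{F. closed F \<and> F \<inter> K = {}} | K. compact K} \<union>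
    {{F. closed F \<and> F \<inter> G \<noteq> {}} | G. open G}"
  then consider K where "compact K" "U = {F. closed F \<and> F \<inter> K = {}}"
    | G where "open G" "U = {F. closed F \<and> F \<inter> G \<noteq> {}}"
    by blast
  then show "openin euclidean ((\<lambda>p. p ` I) -` U \<inter> topspace euclidean)"
  proof cases
    case 1
    have "(\<lambda>p. p ` I) -` U = (\<Inter>i\<in>I. (\<lambda>p. p i) -` (- K))"
      using 1 assms by (auto simp: finite_imp_closed)
    moreover have "open ((\<lambda>p :: 'i \<Rightarrow> 'a. p i) -` (- K))" for i
      by (rule open_vimage) (auto simp: open_Compl compact_imp_closed 1)
    ultimately show ?thesis
      using assms by (auto intro!: open_INT)
  next
    case 2
    have "(\<lambda>p. p ` I) -` U = (\<Union>i\<in>I. (\<lambda>p. p i) -` G)"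
      using 2 assms by (auto simp: finite_imp_closed)
    moreover have "open ((\<lambda>p :: 'i \<Rightarrow> 'a. p i) -` G)" for i
      by (rule open_vimage) (auto simp: 2)
    ultimately show ?thesis
      using assms by auto
  qed
next
  show "(\<lambda>p :: 'i \<Rightarrow> 'a. p ` I) ` topspace euclidean \<subseteq>
    \<Union> ({{F. closed F \<and> F \<inter> K = {}} | K. compact K} \<union>
      {{F. closed F \<and> F \<inter> G \<noteq> {}} | G :: 'a set. open G})"
    using topspace_fell_topology[where 'a = 'a] assms
    unfolding fell_topology_def topology_generated_by_topspace
    by (simp add: image_subset_iff finite_imp_closed)
qed

lemma measurable_finite_set_fell:
  fixes f :: "'i::countable \<Rightarrow> 'w \<Rightarrow> 'a::{second_countable_topology,t2_space}"
  assumes "finite I" and "\<And>i. i \<in> I \<Longrightarrow> f i \<in> borel_measurable M"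
  shows "(\<lambda>\<omega>. (\<lambda>i. f i \<omega>) ` I)
    \<in> measurable M (sigma (topspace fell_topology) {U. openin fell_topology U})"
proof (rule measurable_measure_of)
  show "{U. openin fell_topology U} \<subseteq> Pow (topspace (fell_topology :: 'a set topology))"
  proof
    fix U :: "'a set set" assume "U \<in> {U. openin fell_topology U}"
    then show "U \<in> Pow (topspace fell_topology)"
      using openin_subset[of fell_topology U] by simp
  qed
  show "(\<lambda>\<omega>. (\<lambda>i. f i \<omega>) ` I) \<in> space M \<rightarrow> topspace fell_topology"
    using assms(1) by (simp add: topspace_fell_topology finite_imp_closed)
  fix U :: "'a set set" assume "U \<in> {U. openin fell_topology U}"
  then have "open {p :: 'i \<Rightarrow> 'a. p ` I \<in> U}"
    using openin_continuous_map_preimage[OF continuous_map_finite_set[OF assms(1)], of U] by simp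
  then have U: "{p :: 'i \<Rightarrow> 'a. p ` I \<in> U} \<in> sets borel" by simp
  define g where "g \<omega> i = (if i \<in> I then f i \<omega> else undefined)" for \<omega> i
  have "g \<in> borel_measurable M"
    unfolding g_def
  proof (rule measurable_coordinatewise_then_product)
    show "(\<lambda>\<omega>. if i \<in> I then f i \<omega> else undefined) \<in> borel_measurable M" for i
      by (cases "i \<in> I") (simp_all add: assms(2))
  qed
  then have "g -` {p. p ` I \<in> U} \<inter> space M \<in> sets M"
    using U by (rule measurable_sets)
  moreover have "g \<omega> ` I = (\<lambda>i. f i \<omega>) ` I" for \<omega>
    unfolding g_def by auto
  ultimately show "(\<lambda>\<omega>. (\<lambda>i. f i \<omega>) ` I) -` U \<inter> space M \<in> sets M"
    by (simp add: vimage_def)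
qed

section \<open>Order statistics and points of the mean excess plot\<close>

text \<open>All that is used about order statistics: they are the generalized inverse of the count of
  exceedances, whatever the ties.\<close>

lemma order_stat_gt_iff:
  assumes "1 \<le> i" "i \<le> n"
  shows "order_stat x n i > u \<longleftrightarrow> i \<le> card {j\<in>{1..n}. x j > u}"
proof -
  define L where "L = sort (map x [1..<Suc n])"
  have len: "length L = n" by (simp add: L_def)
  have os: "order_stat x n i = L ! (n - i)"
    unfolding order_stat_def L_def[symmetric] using assms len by (simp add: rev_nth)
  have "card {j\<in>{1..n}. x j > u} = length (filter (\<lambda>j. x j > u) [1..<Suc n])"
  proof -
    have "{j\<in>{1..n}. x j > u} = set (filter (\<lambda>j. x j > u) [1..<Suc n])" by auto
    then show ?thesis
      using distinct_card[of "filter (\<lambda>j. x j > u) [1..<Suc n]"] by simp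
  qed
  also have "\<dots> = length (filter (\<lambda>v. v > u) (map x [1..<Suc n]))"
    by (simp add: filter_map comp_def)
  also have "\<dots> = length (filter (\<lambda>v. v > u) L)"
    by (simp add: L_def filter_sort)
  also have "\<dots> = card {m. m < n \<and> L ! m > u}"
    by (simp add: length_filter_conv_card len)
  finally have card_eq: "card {j\<in>{1..n}. x j > u} = card {m. m < n \<and> L ! m > u}" .
  have mono: "L ! m \<le> L ! m'" if "m \<le> m'" "m' < n" for m m'
    using that sorted_nth_mono[of L m m'] by (simp add: L_def)
  show ?thesis
  proof
    assume "order_stat x n i > u"
    then have "{n - i..<n} \<subseteq> {m. m < n \<and> L ! m > u}"
      using mono[of "n - i"] assms by (force simp: os)
    then have "card {n - i..<n} \<le> card {m. m < n \<and> L ! m > u}"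
      by (intro card_mono) auto
    then show "i \<le> card {j\<in>{1..n}. x j > u}"
      using assms card_eq by simp
  next
    assume i: "i \<le> card {j\<in>{1..n}. x j > u}"
    show "order_stat x n i > u"
    proof (rule ccontr)
      assume "\<not> order_stat x n i > u"
      then have "{m. m < n \<and> L ! m > u} \<subseteq> {Suc (n - i)..<n}"
        using mono[of _ "n - i"] assms by (force simp: os not_le Suc_le_eq)
      then have "card {m. m < n \<and> L ! m > u} \<le> card {Suc (n - i)..<n}"
        by (intro card_mono) auto
      then show False
        using i card_eq assms by simp
    qed
  qed
qed

lemma order_stat_antimono:
  assumes "1 \<le> i" "i \<le> j" "j \<le> n"
  shows "order_stat x n j \<le> order_stat x n i"
proof (rule ccontr)
  assume "\<not> ?thesis"
  then have "j \<le> card {l\<in>{1..n}. x l > order_stat x n i}"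
    using order_stat_gt_iff[of j n "order_stat x n i" x] assms by simp
  then show False
    using order_stat_gt_iff[of i n "order_stat x n i" x] assms by simp
qed

lemma me_plot_set_eq_image:
  "me_plot_set x n k = (\<lambda>l. ((order_stat x n l - order_stat x n k) / (order_stat x n 1 - order_stat x n k),
     emp_mean_excess x n (order_stat x n l) / (order_stat x n 1 - order_stat x n k))) ` {2..k}"
proof -
  have "{(order_stat x n i - order_stat x n k, emp_mean_excess x n (order_stat x n i)) | i. 1 < i \<and> i \<le> k}
      = (\<lambda>l. (order_stat x n l - order_stat x n k, emp_mean_excess x n (order_stat x n l))) ` {2..k}"
    by (auto simp: image_iff Bex_def Suc_le_eq numeral_2_eq_2)
  then show ?thesis
    unfolding me_plot_set_def by (simp add: image_image scaleR_prod_def mult.commute divide_inverse)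
qed

lemma finite_me_plot_set: "finite (me_plot_set x n k)"
  by (simp add: me_plot_set_eq_image)

lemma sum_of_bool_eq_card:
  "finite A \<Longrightarrow> (\<Sum>j\<in>A. of_bool (P j)) = real (card {j\<in>A. P j})"
  by (simp add: of_bool_def Int_def flip: sum.inter_filter)

text \<open>In terms of distances to \<open>e\<close> in the unit \<open>s\<close>, the excess over the level \<open>e - s * y\<close> becomes the
  positive part of \<open>y\<close> minus the distance.\<close>

lemma emp_mean_excess_affine:
  assumes "0 < s"
  shows "emp_mean_excess x n (e - s * y)
    = s * ((\<Sum>j=1..n. max 0 (y - (e - x j) / s)) / real (card {j\<in>{1..n}. (e - x j) / s < y}))"
proof -
  have iff: "x j > e - s * y \<longleftrightarrow> (e - x j) / s < y" for j
    using assms by (simp add: pos_divide_less_eq algebra_simps)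
  have "(x j - (e - s * y)) * of_bool (x j > e - s * y) = s * max 0 (y - (e - x j) / s)" for j
  proof -
    define d where "d = (e - x j) / s"
    have "x j - (e - s * y) = s * (y - d)"
      using assms by (simp add: d_def field_simps)
    then show ?thesis
      unfolding iff d_def[symmetric] by (cases "d < y") (simp_all add: max_def)
  qed
  then have "emp_mean_excess x n (e - s * y)
      = (\<Sum>j=1..n. s * max 0 (y - (e - x j) / s)) / (\<Sum>j=1..n. of_bool ((e - x j) / s < y))"
    unfolding emp_mean_excess_def iff by simp
  then show ?thesis
    by (simp only: sum_of_bool_eq_card finite_atLeastAtMost times_divide_eq_right flip: sum_distrib_left)
qed

lemma borel_measurable_order_stat:
  assumes X: "\<And>j. j \<in> {1..n} \<Longrightarrow> X j \<in> borel_measurable M" and "1 \<le> i" "i \<le> n"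
  shows "(\<lambda>\<omega>. order_stat (\<lambda>j. X j \<omega>) n i) \<in> borel_measurable M"
  unfolding borel_measurable_iff_greater
proof
  fix u :: real
  have "(order_stat (\<lambda>j. X j \<omega>) n i > u) \<longleftrightarrow> real i \<le> (\<Sum>j\<in>{1..n}. if X j \<omega> > u then 1 else 0)" for \<omega>
    unfolding order_stat_gt_iff[OF assms(2,3)] by (simp flip: sum.inter_filter)
  moreover have "{\<omega> \<in> space M. real i \<le> (\<Sum>j\<in>{1..n}. if X j \<omega> > u then 1 else 0)} \<in> sets M"
    using X by measurable
  ultimately show "{\<omega> \<in> space M. u < order_stat (\<lambda>j. X j \<omega>) n i} \<in> sets M"
    by simp
qed

lemma borel_measurable_emp_mean_excess:
  assumes X: "\<And>j. j \<in> {1..n} \<Longrightarrow> X j \<in> borel_measurable M" and g: "g \<in> borel_measurable M"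
  shows "(\<lambda>\<omega>. emp_mean_excess (\<lambda>j. X j \<omega>) n (g \<omega>)) \<in> borel_measurable M"
  unfolding emp_mean_excess_def of_bool_def using X g by measurable

lemma measurable_me_plot_set:
  assumes X: "\<And>j. j \<in> {1..n} \<Longrightarrow> X j \<in> borel_measurable M" and "k \<le> n"
  shows "(\<lambda>\<omega>. me_plot_set (\<lambda>j. X j \<omega>) n k)
    \<in> measurable M (sigma (topspace fell_topology) {U. openin fell_topology U})"
  unfolding me_plot_set_eq_image
proof (rule measurable_finite_set_fell)
  fix l assume l: "l \<in> {2..k}"
  have os: "(\<lambda>\<omega>. order_stat (\<lambda>j. X j \<omega>) n i) \<in> borel_measurable M" if "i \<in> {1, k, l}" for i
    using that l \<open>k \<le> n\<close> by (intro borel_measurable_order_stat X) auto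
  have "(\<lambda>\<omega>. emp_mean_excess (\<lambda>j. X j \<omega>) n (order_stat (\<lambda>j. X j \<omega>) n l)) \<in> borel_measurable M"
    by (intro borel_measurable_emp_mean_excess X os) auto
  then show "(\<lambda>\<omega>. ((order_stat (\<lambda>j. X j \<omega>) n l - order_stat (\<lambda>j. X j \<omega>) n k) /
        (order_stat (\<lambda>j. X j \<omega>) n 1 - order_stat (\<lambda>j. X j \<omega>) n k),
      emp_mean_excess (\<lambda>j. X j \<omega>) n (order_stat (\<lambda>j. X j \<omega>) n l) /
        (order_stat (\<lambda>j. X j \<omega>) n 1 - order_stat (\<lambda>j. X j \<omega>) n k))) \<in> borel_measurable M"
    using os[of 1] os[of k] os[of l] by (intro borel_measurable_Pair borel_measurable_divide borel_measurable_diff) auto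
qed simp

section \<open>Regular variation at the right end point\<close>

text \<open>Substituting \<open>t = 1 / s\<close> turns regular variation at infinity into regular variation of
  \<open>1 - F (xF - s)\<close> at \<open>0\<close>, with the sign of the index reversed.\<close>

lemma regularly_varying_at_endpoint:
  assumes "regularly_varying (\<lambda>x. 1 - F (xF - 1 / x)) \<rho>" "0 < x"
  shows "((\<lambda>s. (1 - F (xF - s * x)) / (1 - F (xF - s))) \<longlongrightarrow> x powr (- \<rho>)) (at_right 0)"
proof -
  have "((\<lambda>t. (1 - F (xF - 1 / (t * (1 / x)))) / (1 - F (xF - 1 / t))) \<longlongrightarrow> (1 / x) powr \<rho>) at_top"
    using assms(1)[unfolded regularly_varying_def, THEN conjunct2, rule_format, of "1 / x"] assms(2)
    by (simp del: divide_divide_eq_right times_divide_eq_right)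
  from filterlim_compose[OF this filterlim_inverse_at_top_right]
  have "((\<lambda>s. (1 - F (xF - s * x)) / (1 - F (xF - s))) \<longlongrightarrow> (1 / x) powr \<rho>) (at_right 0)"
    using assms(2) by (simp add: inverse_eq_divide)
  then show ?thesis
    using assms(2) by (simp add: powr_divide powr_minus_divide)
qed

text \<open>Each halving of the argument near \<open>0\<close> divides \<open>G\<close> by a factor bounded away from \<open>1\<close>. In
  particular, a distribution whose tail is regularly varying in this way has no mass at the end
  point.\<close>

lemma regularly_varying_tendsto_0:
  fixes G :: "real \<Rightarrow> real"
  assumes mono: "\<And>s t. 0 < s \<Longrightarrow> s \<le> t \<Longrightarrow> G s \<le> G t"
    and pos: "\<And>s. 0 < s \<Longrightarrow> 0 < G s"
    and rv: "((\<lambda>s. G (s * 2) / G s) \<longlongrightarrow> c) (at_right 0)"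
    and "1 < c" "0 < (\<epsilon>::real)"
  obtains s where "0 < s" "G s < \<epsilon>"
proof -
  define r where "r = (1 + c) / 2"
  have r: "1 < r" "r < c" using \<open>1 < c\<close> by (auto simp: r_def)
  have "\<forall>\<^sub>F s in at_right 0. r < G (s * 2) / G s"
    using order_tendstoD(1)[OF rv r(2)] .
  then obtain b where b: "0 < b" "\<And>s. 0 < s \<Longrightarrow> s < b \<Longrightarrow> r < G (s * 2) / G s"
    by (auto simp: eventually_at_right_field)
  have step: "r * G s \<le> G (s * 2)" if "0 < s" "s < b" for s
    using b(2)[OF that] pos[OF that(1)] by (simp add: less_divide_eq)
  have iter: "r ^ m * G (b / 2 / 2 ^ m) \<le> G (b / 2)" for m
  proof (induction m)
    case (Suc m)
    have "b / 2 / 2 ^ Suc m < b"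
    proof -
      have "b / 2 / 2 ^ Suc m \<le> b / 2 / 1"
        using b(1) by (intro divide_left_mono) (use one_le_power[of "2::real" "Suc m"] in auto)
      then show ?thesis using b(1) by simp
    qed
    then have "r * G (b / 2 / 2 ^ Suc m) \<le> G (b / 2 / 2 ^ Suc m * 2)"
      using b(1) by (intro step) auto
    then have "r * G (b / 2 / 2 ^ Suc m) \<le> G (b / 2 / 2 ^ m)"
      by (simp add: field_simps)
    then have "r ^ m * (r * G (b / 2 / 2 ^ Suc m)) \<le> r ^ m * G (b / 2 / 2 ^ m)"
      using r(1) by (intro mult_left_mono) auto
    then show ?case using Suc by (simp add: mult.assoc mult.left_commute)
  qed simp
  obtain m where m: "G (b / 2) / \<epsilon> < r ^ m"
    using real_arch_pow[OF r(1)] by blast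
  have "G (b / 2) < r ^ m * \<epsilon>"
    using m \<open>0 < \<epsilon>\<close> by (simp add: divide_less_eq)
  then have "r ^ m * G (b / 2 / 2 ^ m) < r ^ m * \<epsilon>"
    using iter[of m] by linarith
  then have "G (b / 2 / 2 ^ m) < \<epsilon>"
    using r(1) by (simp add: mult_less_cancel_left_pos)
  then show thesis
    using that[of "b / 2 / 2 ^ m"] b(1) by simp
qed

text \<open>An asymptotic inverse of \<open>G\<close>. Take for \<open>s n\<close> the infimum of the points where \<open>G\<close> is at least
  \<open>p n\<close>. As \<open>G\<close> may jump, \<open>G (s n)\<close> itself need not be comparable to \<open>p n\<close> a priori, but
  \<open>G (s n * y)\<close> is below \<open>p n\<close> for \<open>y < 1\<close> and at least \<open>p n\<close> for \<open>y > 1\<close>. Comparing with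
  \<open>G (s n * x) / G (s n * y)\<close>, which tends to \<open>(x / y) powr a\<close>, and letting \<open>y\<close> approach \<open>1\<close> from
  either side gives the limit.\<close>

lemma regularly_varying_threshold:
  fixes G :: "real \<Rightarrow> real" and p :: "nat \<Rightarrow> real"
  assumes mono: "\<And>s t. 0 < s \<Longrightarrow> s \<le> t \<Longrightarrow> G s \<le> G t"
    and pos: "\<And>s. 0 < s \<Longrightarrow> 0 < G s"
    and rv: "\<And>x. 0 < x \<Longrightarrow> ((\<lambda>s. G (s * x) / G s) \<longlongrightarrow> x powr a) (at_right 0)"
    and "0 < a"
    and p: "p \<longlonglongrightarrow> 0" "\<forall>\<^sub>F n in sequentially. 0 < p n"
  obtains s where "\<forall>\<^sub>F n in sequentially. 0 < s n"
    and "\<And>x. 0 < x \<Longrightarrow> (\<lambda>n. G (s n * x) / p n) \<longlonglongrightarrow> x powr a"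
proof -
  define S where "S n = {s. 0 < s \<and> p n \<le> G s}" for n
  define s where "s n = Inf (S n)" for n
  have bdd: "bdd_below (S n)" for n by (rule bdd_belowI[of _ 0]) (auto simp: S_def)
  have le: "s n \<le> t" if "0 < t" "p n \<le> G t" for n t
    unfolding s_def using bdd that by (auto intro!: cInf_lower simp: S_def)
  have ne: "\<forall>\<^sub>F n in sequentially. S n \<noteq> {}"
    using order_tendstoD(2)[OF p(1) pos[of 1]] by (auto elim!: eventually_mono simp: S_def intro!: exI[of _ 1])
  have s_pos: "\<forall>\<^sub>F n in sequentially. 0 < s n"
    using ne p(2)
  proof eventually_elim
    case (elim n)
    have "1 < (2::real) powr a" using \<open>0 < a\<close> by simp
    then obtain t where t: "0 < t" "G t < p n"
      using regularly_varying_tendsto_0[OF mono pos rv[of 2]] elim(2) by auto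
    have "t \<le> s n" unfolding s_def
    proof (rule cInf_greatest[OF elim(1)])
      fix v assume "v \<in> S n"
      then show "t \<le> v"
        using t mono[of v t] by (force simp: S_def)
    qed
    then show ?case using t(1) by simp
  qed
  have "s \<longlonglongrightarrow> 0"
  proof (rule order_tendstoI)
    fix c :: real assume "c < 0"
    then show "\<forall>\<^sub>F n in sequentially. c < s n"
      using s_pos by (auto elim: eventually_mono)
  next
    fix c :: real assume "0 < c"
    then have "\<forall>\<^sub>F n in sequentially. p n < G (c / 2)"
      using pos by (intro order_tendstoD(2)[OF p(1)]) auto
    then show "\<forall>\<^sub>F n in sequentially. s n < c"
    proof eventually_elim
      case (elim n)
      then show ?case using le[of "c / 2" n] \<open>0 < c\<close> by simp
    qed
  qed
  then have s0: "filterlim s (at_right 0) sequentially"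
    using s_pos by (intro tendsto_imp_filterlim_at_right)
  have below: "\<forall>\<^sub>F n in sequentially. G (s n * y) < p n" if "0 < y" "y < 1" for y
    using s_pos
  proof eventually_elim
    case (elim n)
    have "0 < s n * y" "s n * y < s n" using elim that by auto
    then show ?case using le[of "s n * y" n] by linarith
  qed
  have above: "\<forall>\<^sub>F n in sequentially. p n \<le> G (s n * y)" if "1 < y" for y
    using s_pos ne
  proof eventually_elim
    case (elim n)
    have "s n < s n * y" using elim(1) that by simp
    then obtain v where "v \<in> S n" "v < s n * y"
      using cInf_less_iff[OF elim(2) bdd] by (auto simp: s_def)
    then show ?case
      using mono[of v "s n * y"] by (auto simp: S_def)
  qed
  have ratio: "(\<lambda>n. G (s n * x) / G (s n * y)) \<longlonglongrightarrow> (x / y) powr a" if "0 < x" "0 < y" for x y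
  proof -
    have "filterlim (\<lambda>n. s n * y) (at_right 0) sequentially"
    proof (rule tendsto_imp_filterlim_at_right)
      show "(\<lambda>n. s n * y) \<longlonglongrightarrow> 0" using tendsto_mult_right[OF \<open>s \<longlonglongrightarrow> 0\<close>, of y] by simp
      show "\<forall>\<^sub>F n in sequentially. 0 < s n * y" using s_pos that by (auto elim!: eventually_mono)
    qed
    from filterlim_compose[OF rv[of "x / y"] this] show ?thesis
      using that by (simp add: mult.assoc)
  qed
  show thesis
  proof (rule that[OF s_pos])
    fix x :: real assume x: "0 < x"
    have cont: "((\<lambda>y. (x / y) powr a) \<longlongrightarrow> x powr a) (at 1)"
    proof -
      have "((\<lambda>y. (x / y) powr a) \<longlongrightarrow> (x / 1) powr a) (at 1)"
        using x by (intro tendsto_intros) auto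
      then show ?thesis by simp
    qed
    show "(\<lambda>n. G (s n * x) / p n) \<longlonglongrightarrow> x powr a"
    proof (rule order_tendstoI)
      fix c assume "c < x powr a"
      then have "\<forall>\<^sub>F y in at_right 1. c < (x / y) powr a"
        using order_tendstoD(1)[OF cont] by (simp add: eventually_at_split)
      then obtain b where b: "b > 1" "\<And>y. 1 < y \<Longrightarrow> y < b \<Longrightarrow> c < (x / y) powr a"
        by (auto simp: eventually_at_right_field)
      define y where "y = (1 + b) / 2"
      have "1 < y" "y < b" using b(1) by (auto simp: y_def)
      then have y: "1 < y" "c < (x / y) powr a" using b(2) by auto
      have "\<forall>\<^sub>F n in sequentially. c < G (s n * x) / G (s n * y)"
        using order_tendstoD(1)[OF ratio y(2)] x y(1) by simp
      with above[OF y(1)] p(2) s_pos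
      show "\<forall>\<^sub>F n in sequentially. c < G (s n * x) / p n"
      proof eventually_elim
        case (elim n)
        have "G (s n * x) / G (s n * y) \<le> G (s n * x) / p n"
          using elim x by (intro divide_left_mono mult_pos_pos less_imp_le[OF pos]) auto
        then show ?case using elim by linarith
      qed
    next
      fix c assume "x powr a < c"
      then have "\<forall>\<^sub>F y in at_left 1. (x / y) powr a < c"
        using order_tendstoD(2)[OF cont] by (simp add: eventually_at_split)
      then obtain b where b: "b < 1" "\<And>y. b < y \<Longrightarrow> y < 1 \<Longrightarrow> (x / y) powr a < c"
        by (auto simp: eventually_at_left_field)
      define y where "y = (1 + max 0 b) / 2"
      have "0 < y" "y < 1" "b < y" using b(1) by (auto simp: y_def max_def)
      then have y: "0 < y" "y < 1" "(x / y) powr a < c" using b(2) by auto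
      have "\<forall>\<^sub>F n in sequentially. G (s n * x) / G (s n * y) < c"
        using order_tendstoD(2)[OF ratio y(3)] x y(1) by simp
      with below[OF y(1,2)] p(2) s_pos
      show "\<forall>\<^sub>F n in sequentially. G (s n * x) / p n < c"
      proof eventually_elim
        case (elim n)
        have "0 < G (s n * y)" "0 < G (s n * x)" using elim x y pos by auto
        then have "G (s n * x) / p n \<le> G (s n * x) / G (s n * y)"
          using elim by (intro divide_left_mono mult_pos_pos) auto
        then show ?case using elim by linarith
      qed
    qed
  qed
qed

section \<open>Uniform convergence of the rescaled mean excess\<close>

text \<open>Polya's theorem: on a grid fine enough for the modulus of continuity of the limit, convergence
  holds simultaneously, and monotonicity controls the functions between neighbouring grid points.\<close>

lemma monotone_pointwise_imp_uniform_limit: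
  fixes f :: "'i \<Rightarrow> real \<Rightarrow> real"
  assumes mono: "\<forall>\<^sub>F i in \<F>. mono_on {a..b} (f i)"
    and cont: "continuous_on {a..b} g"
    and lim: "\<And>x. x \<in> {a..b} \<Longrightarrow> ((\<lambda>i. f i x) \<longlongrightarrow> g x) \<F>"
  shows "uniform_limit {a..b} f g \<F>"
proof (cases "a \<le> b")
  case True
  show ?thesis
  proof (rule uniform_limitI)
    fix e :: real assume "0 < e"
    have "uniformly_continuous_on {a..b} g"
      using cont by (rule compact_uniformly_continuous) simp
    then obtain d where d: "0 < d"
      "\<And>x y. x \<in> {a..b} \<Longrightarrow> y \<in> {a..b} \<Longrightarrow> dist y x < d \<Longrightarrow> dist (g y) (g x) < e / 2"
      using \<open>0 < e\<close> unfolding uniformly_continuous_on_def by (metis half_gt_zero)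
    define h where "h = d / 2"
    have h: "0 < h" "h < d" using d(1) by (auto simp: h_def)
    define P where "P m = min b (a + real m * h)" for m
    define N where "N = nat \<lfloor>(b - a) / h\<rfloor>"
    have P_in: "P m \<in> {a..b}" for m
      using True h(1) by (auto simp: P_def)
    have "\<forall>\<^sub>F i in \<F>. \<forall>m\<in>{..Suc N}. dist (f i (P m)) (g (P m)) < e / 2"
      using \<open>0 < e\<close> P_in by (intro eventually_ball_finite ballI tendstoD lim) auto
    with mono show "\<forall>\<^sub>F i in \<F>. \<forall>x\<in>{a..b}. dist (f i x) (g x) < e"
    proof eventually_elim
      case (elim i)
      show ?case
      proof
        fix x assume x: "x \<in> {a..b}"
        define m where "m = nat \<lfloor>(x - a) / h\<rfloor>"
        have "m \<le> N"
          unfolding m_def N_def using x h(1) by (intro nat_mono floor_mono divide_right_mono) auto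
        have m: "real m \<le> (x - a) / h" "(x - a) / h < real m + 1"
          unfolding m_def using x h(1) by auto
        have m': "a + real m * h \<le> x" "x < a + (real m + 1) * h"
          using m h(1) by (auto simp: field_simps)
        have Pm: "P m \<le> x" "x \<le> P (Suc m)"
          using m' x by (auto simp: P_def algebra_simps)
        have close: "dist (P m) x < d" "dist (P (Suc m)) x < d"
          using m' x h by (auto simp: P_def dist_real_def algebra_simps min_def)
        have g: "dist (g (P m)) (g x) < e / 2" "dist (g (P (Suc m))) (g x) < e / 2"
          using d(2) x P_in close by auto
        have f: "dist (f i (P m)) (g (P m)) < e / 2"
          "dist (f i (P (Suc m))) (g (P (Suc m))) < e / 2"
          using elim(2) \<open>m \<le> N\<close> by auto
        have "f i (P m) \<le> f i x" "f i x \<le> f i (P (Suc m))"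
          using elim(1) Pm x P_in by (auto intro: mono_onD)
        then show "dist (f i x) (g x) < e"
          using f g unfolding dist_real_def by linarith
      qed
    qed
  qed
qed (auto intro!: uniform_limitI)

text \<open>The excess over a single value is the integral of a step function, so that sums of excesses are
  integrals of counts.\<close>

lemma has_integral_step:
  fixes d y :: real
  assumes "0 \<le> d" "0 \<le> y"
  shows "((\<lambda>t. of_bool (d < t)) has_integral max 0 (y - d)) {0..y}"
proof (cases "d \<le> y")
  case True
  have 1: "((\<lambda>t. of_bool (d < t) :: real) has_integral 0) {0..d}"
    by (rule has_integral_is_0) auto
  have "((\<lambda>t. 1 :: real) has_integral (y - d)) {d..y}"
    using has_integral_const_real[of "1::real" d y] True by simp
  then have 2: "((\<lambda>t. of_bool (d < t) :: real) has_integral (y - d)) {d..y}"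
    by (rule has_integral_spike_finite[of "{d}", rotated -1]) auto
  show ?thesis
    using has_integral_combine[OF assms(1) True 1 2] True by simp
next
  case False
  then show ?thesis
    by (auto intro!: has_integral_is_0)
qed

lemma sum_excess_near_integral:
  fixes D :: "nat \<Rightarrow> real"
  assumes "finite A" "\<And>j. j \<in> A \<Longrightarrow> 0 \<le> D j" "0 < a" "0 \<le> y"
    and near: "\<And>t. t \<in> {0..y} \<Longrightarrow> \<bar>real (card {j\<in>A. D j < t}) / c - t powr a\<bar> \<le> \<delta>"
  shows "\<bar>(\<Sum>j\<in>A. max 0 (y - D j)) / c - y powr (a + 1) / (a + 1)\<bar> \<le> \<delta> * y"
proof -
  have "((\<lambda>t. \<Sum>j\<in>A. of_bool (D j < t) :: real) has_integral (\<Sum>j\<in>A. max 0 (y - D j))) {0..y}"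
    using assms by (intro has_integral_sum has_integral_step) auto
  then have "((\<lambda>t. (\<Sum>j\<in>A. of_bool (D j < t)) / c) has_integral (\<Sum>j\<in>A. max 0 (y - D j)) / c) {0..y}"
    by (rule has_integral_divide)
  moreover have "((\<lambda>t. t powr a) has_integral y powr (a + 1) / (a + 1)) {0..y}"
    using assms by (intro has_integral_powr_from_0) auto
  ultimately have *: "((\<lambda>t. (\<Sum>j\<in>A. of_bool (D j < t)) / c - t powr a) has_integral
      (\<Sum>j\<in>A. max 0 (y - D j)) / c - y powr (a + 1) / (a + 1)) {0..y}"
    by (rule has_integral_diff)
  have "0 \<le> \<delta>" using order_trans[OF abs_ge_zero near[of 0]] assms(4) by simp
  have "norm ((\<Sum>j\<in>A. of_bool (D j < t)) / c - t powr a) \<le> \<delta>" if "t \<in> {0..y} - {}" for t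
    unfolding sum_of_bool_eq_card[OF assms(1)] real_norm_def using near that by blast
  from has_integral_bound_real[OF \<open>0 \<le> \<delta>\<close> finite.emptyI * this]
  show ?thesis using assms(4) by simp
qed

text \<open>The mean excess is the integral of the normalised count divided by the count. Away from \<open>0\<close> the
  denominator is bounded below, and the quotient of the limits is
  \<open>(y powr (a + 1) / (a + 1)) / y powr a = y / (a + 1)\<close>. Near \<open>0\<close> the denominator degenerates, but
  there both the mean excess and its limit lie between \<open>0\<close> and \<open>y\<close>.\<close>

lemma mean_excess_uniform_limit:
  fixes D :: "'i \<Rightarrow> nat \<Rightarrow> real" and n k :: "'i \<Rightarrow> nat"
  assumes "0 < a"
    and kpos: "\<forall>\<^sub>F i in \<F>. 0 < k i"
    and nonneg: "\<forall>\<^sub>F i in \<F>. \<forall>j\<in>{1..n i}. 0 \<le> D i j"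
    and lim: "\<And>y. 0 < y \<Longrightarrow>
      ((\<lambda>i. real (card {j\<in>{1..n i}. D i j < y}) / real (k i)) \<longlongrightarrow> y powr a) \<F>"
  shows "uniform_limit {0..R}
    (\<lambda>i y. (\<Sum>j=1..n i. max 0 (y - D i j)) / real (card {j\<in>{1..n i}. D i j < y}))
    (\<lambda>y. y / (a + 1)) \<F>"
proof (rule uniform_limitI)
  fix \<epsilon> :: real assume "0 < \<epsilon>"
  define \<nu> where "\<nu> i y = real (card {j\<in>{1..n i}. D i j < y}) / real (k i)" for i y
  have unif: "uniform_limit {0..R} \<nu> (\<lambda>y. y powr a) \<F>"
  proof (rule monotone_pointwise_imp_uniform_limit)
    show "\<forall>\<^sub>F i in \<F>. mono_on {0..R} (\<nu> i)"
    proof (intro always_eventually allI mono_onI)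
      fix i and r t :: real assume "r \<le> t"
      then show "\<nu> i r \<le> \<nu> i t"
        unfolding \<nu>_def by (intro divide_right_mono of_nat_mono card_mono) auto
    qed
    show "continuous_on {0..R} (\<lambda>y. y powr a)"
      using \<open>0 < a\<close> by (intro continuous_on_powr') (auto intro: continuous_intros)
    fix y assume "y \<in> {0..R}"
    show "((\<lambda>i. \<nu> i y) \<longlongrightarrow> y powr a) \<F>"
    proof (cases "y = 0")
      case True
      have "\<forall>\<^sub>F i in \<F>. \<nu> i y = y powr a"
        using nonneg
      proof eventually_elim
        case (elim i)
        then have "{j\<in>{1..n i}. D i j < y} = {}" using True by force
        then have "card {j\<in>{1..n i}. D i j < y} = 0" by (simp only: card.empty)
        then show ?case unfolding \<nu>_def using True by simp
      qed
      then show ?thesis by (rule tendsto_eventually)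
    next
      case False
      then show ?thesis using lim[of y] \<open>y \<in> {0..R}\<close> by (simp add: \<nu>_def)
    qed
  qed
  \<comment> \<open>Below \<open>\<theta>\<close> the trivial bound by \<open>y\<close> is used. Above it the count is at
    least \<open>\<eta> / 2\<close>, and the error of the quotient is at most \<open>2 * \<delta> * R\<close> divided by this bound.\<close>
  define \<theta> where "\<theta> = \<epsilon> / 2"
  define \<eta> where "\<eta> = \<theta> powr a"
  define \<delta> where "\<delta> = min (\<eta> / 2) (\<eta> * \<epsilon> / (8 * (\<bar>R\<bar> + 1)))"
  have \<theta>: "0 < \<theta>" "\<theta> < \<epsilon>" "0 < \<eta>" using \<open>0 < \<epsilon>\<close> by (auto simp: \<theta>_def \<eta>_def)
  then have \<delta>: "0 < \<delta>" "\<delta> \<le> \<eta> / 2" "\<delta> \<le> \<eta> * \<epsilon> / (8 * (\<bar>R\<bar> + 1))"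
    using \<open>0 < \<epsilon>\<close> unfolding \<delta>_def by (simp_all only: min_less_iff_conj min.cobounded1 min.cobounded2) auto
  have \<delta>': "8 * \<delta> * (\<bar>R\<bar> + 1) \<le> \<eta> * \<epsilon>"
    using \<delta>(3) by (simp add: pos_le_divide_eq mult.commute mult.left_commute)
  have "\<forall>\<^sub>F i in \<F>. \<forall>y\<in>{0..R}. dist (\<nu> i y) (y powr a) < \<delta>"
    using unif \<delta>(1) by (rule uniform_limitD)
  with nonneg kpos
  show "\<forall>\<^sub>F i in \<F>. \<forall>y\<in>{0..R}.
      dist ((\<Sum>j=1..n i. max 0 (y - D i j)) / real (card {j\<in>{1..n i}. D i j < y})) (y / (a + 1)) < \<epsilon>"
  proof eventually_elim
    case (elim i)
    show ?case
    proof
      fix y assume y: "y \<in> {0..R}"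
      define c where "c = real (card {j\<in>{1..n i}. D i j < y})"
      define s where "s = (\<Sum>j=1..n i. max 0 (y - D i j))"
      have s: "0 \<le> s" "s \<le> y * c"
      proof -
        show "0 \<le> s" unfolding s_def by (intro sum_nonneg) auto
        have "s \<le> (\<Sum>j=1..n i. y * of_bool (D i j < y))"
          unfolding s_def using elim(1) y by (intro sum_mono) (auto simp: of_bool_def)
        also have "\<dots> = y * c"
          unfolding c_def by (simp only: sum_of_bool_eq_card finite_atLeastAtMost flip: sum_distrib_left)
        finally show "s \<le> y * c" .
      qed
      have frac: "0 \<le> s / c" "s / c \<le> y"
        using s y by (auto simp: c_def divide_le_eq)
      have ya: "0 \<le> y / (a + 1)" "y / (a + 1) \<le> y"
        using y \<open>0 < a\<close> by (auto simp: divide_le_eq mult_le_cancel_left1 algebra_simps)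
      have "\<bar>s / c - y / (a + 1)\<bar> < \<epsilon>"
      proof (cases "y \<le> \<theta>")
        case True
        then show ?thesis using frac ya \<theta> by linarith
      next
        case False
        have near: "\<bar>real (card {j\<in>{1..n i}. D i j < t}) / real (k i) - t powr a\<bar> \<le> \<delta>"
          if "t \<in> {0..y}" for t
        proof -
          have "t \<in> {0..R}" using that y by auto
          then show ?thesis
            using elim(3) unfolding \<nu>_def dist_real_def by (blast intro: less_imp_le)
        qed
        have I: "\<bar>s / real (k i) - y powr (a + 1) / (a + 1)\<bar> \<le> \<delta> * y"
          unfolding s_def using elim(1) \<open>0 < a\<close> y near
          by (intro sum_excess_near_integral) auto
        define v where "v = c / real (k i)"
        have v: "\<bar>v - y powr a\<bar> \<le> \<delta>" unfolding v_def c_def using near[of y] y by simp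
        have "\<eta> \<le> y powr a"
          unfolding \<eta>_def using False \<theta>(1) \<open>0 < a\<close> by (intro powr_mono2) auto
        then have v_ge: "\<eta> / 2 \<le> v" using v \<delta>(2) by linarith
        have "y powr (a + 1) = y * y powr a"
          using False \<theta>(1) by (simp add: powr_add)
        then have "s / real (k i) - v * (y / (a + 1))
            = (s / real (k i) - y powr (a + 1) / (a + 1)) + (y / (a + 1)) * (y powr a - v)"
          by (simp add: right_diff_distrib diff_divide_distrib mult.commute)
        also have "\<bar>\<dots>\<bar> \<le> \<delta> * y + y * \<delta>"
        proof (rule order_trans[OF abs_triangle_ineq], rule add_mono[OF I])
          show "\<bar>y / (a + 1) * (y powr a - v)\<bar> \<le> y * \<delta>"
            unfolding abs_mult using ya v by (intro mult_mono) (use \<open>0 < a\<close> y in \<open>auto simp: abs_minus_commute\<close>)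
        qed
        also have "\<dots> \<le> \<delta> * (\<bar>R\<bar> + 1) + \<delta> * (\<bar>R\<bar> + 1)"
          using y \<delta>(1) by (intro add_mono) (auto simp: mult.commute)
        also have "\<dots> \<le> \<eta> * \<epsilon> / 4"
          using \<delta>' by (simp add: algebra_simps)
        also have "\<dots> < \<eta> / 2 * \<epsilon>"
          using \<theta>(3) \<open>0 < \<epsilon>\<close> by simp
        also have "\<dots> \<le> v * \<epsilon>"
          using v_ge \<open>0 < \<epsilon>\<close> by (intro mult_right_mono) auto
        finally have "\<bar>s / real (k i) - v * (y / (a + 1))\<bar> < v * \<epsilon>" .
        moreover have "0 < v" using v_ge \<theta>(3) by linarith
        moreover have "s / c = (s / real (k i)) / v"
          using elim(2) by (simp add: v_def)
        then have "s / c - y / (a + 1) = (s / real (k i) - v * (y / (a + 1))) / v"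
          using \<open>0 < v\<close> by (simp add: diff_divide_distrib)
        ultimately show ?thesis
          by (simp add: abs_divide pos_divide_less_eq mult.commute)
      qed
      then show "dist ((\<Sum>j=1..n i. max 0 (y - D i j)) / real (card {j\<in>{1..n i}. D i j < y}))
          (y / (a + 1)) < \<epsilon>"
        by (simp add: s_def c_def dist_real_def)
    qed
  qed
qed

section \<open>The plot of an array with a power-law count of top values\<close>

text \<open>A family of samples \<open>x i 1, \<dots>, x i (n i)\<close> bounded by \<open>e\<close>, in which the number of values within
  distance \<open>s i * y\<close> of \<open>e\<close> behaves like \<open>k i * y powr a\<close>. Limits are along an arbitrary filter, so
  that convergence in probability is covered as well as ordinary convergence.\<close>

locale top_order_array =
  fixes x :: "'i \<Rightarrow> nat \<Rightarrow> real" and n k :: "'i \<Rightarrow> nat" and s :: "'i \<Rightarrow> real"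
    and e a :: real and \<F> :: "'i filter"
  assumes a_pos: "0 < a"
    and k_at_top: "filterlim k at_top \<F>"
    and k_le_n: "\<forall>\<^sub>F i in \<F>. k i \<le> n i"
    and s_pos: "\<forall>\<^sub>F i in \<F>. 0 < s i"
    and le_endpoint: "\<forall>\<^sub>F i in \<F>. \<forall>j\<in>{1..n i}. x i j \<le> e"
    and count_tendsto: "\<And>y. 0 < y \<Longrightarrow>
      ((\<lambda>i. real (card {j\<in>{1..n i}. x i j > e - s i * y}) / real (k i)) \<longlongrightarrow> y powr a) \<F>"
begin

definition gap :: "'i \<Rightarrow> nat \<Rightarrow> real" where
  "gap i l = (e - order_stat (x i) (n i) l) / s i"

definition num_above :: "'i \<Rightarrow> real \<Rightarrow> nat" where
  "num_above i y = card {j\<in>{1..n i}. x i j > e - s i * y}"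

definition excess :: "'i \<Rightarrow> real \<Rightarrow> real" where
  "excess i y = emp_mean_excess (x i) (n i) (e - s i * y) / s i"

lemma num_above_ratio: "0 < y \<Longrightarrow> ((\<lambda>i. real (num_above i y) / real (k i)) \<longlongrightarrow> y powr a) \<F>"
  using count_tendsto by (simp add: num_above_def)

lemma k_pos: "\<forall>\<^sub>F i in \<F>. 0 < k i"
  using eventually_compose_filterlim[OF eventually_gt_at_top k_at_top] .

lemma k_real_at_top: "filterlim (\<lambda>i. real (k i)) at_top \<F>"
  by (rule filterlim_compose[OF filterlim_real_sequentially k_at_top])

lemma gap_less_iff:
  assumes "0 < s i" "1 \<le> l" "l \<le> n i"
  shows "gap i l < y \<longleftrightarrow> l \<le> num_above i y"
proof -
  have "gap i l < y \<longleftrightarrow> order_stat (x i) (n i) l > e - s i * y"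
    unfolding gap_def using assms(1) by (simp add: pos_divide_less_eq algebra_simps)
  then show ?thesis
    unfolding num_above_def using order_stat_gt_iff[OF assms(2,3)] by simp
qed

lemma gap_mono:
  assumes "0 < s i" "1 \<le> l" "l \<le> m" "m \<le> n i"
  shows "gap i l \<le> gap i m"
  unfolding gap_def using order_stat_antimono[OF assms(2-4)] assms(1) by (intro divide_right_mono) auto

lemma gap_nonneg:
  assumes "0 < s i" "1 \<le> l" "l \<le> n i" "\<forall>j\<in>{1..n i}. x i j \<le> e"
  shows "0 \<le> gap i l"
proof (rule ccontr)
  assume "\<not> 0 \<le> gap i l"
  then have "l \<le> num_above i 0" using gap_less_iff[OF assms(1-3), of 0] by simp
  moreover have "{j\<in>{1..n i}. x i j > e - s i * 0} = {}" using assms(4) by force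
  then have "num_above i 0 = 0" unfolding num_above_def by (simp only: card.empty)
  ultimately show False using assms(2) by simp
qed

text \<open>The difference of two normalised counts has a positive limit, so the difference of the counts
  themselves exceeds any constant. For \<open>y = 0\<close> the subtracted
  count is replaced by its limit \<open>0\<close>, which bounds a single count from below.\<close>

lemma num_above_diff_at_top:
  assumes "0 \<le> y" "y < z"
  shows "\<forall>\<^sub>F i in \<F>. (if y = 0 then 0 else num_above i y) + c \<le> num_above i z"
proof -
  have lim: "((\<lambda>i. (if y = 0 then 0 else real (num_above i y)) / real (k i)) \<longlongrightarrow> y powr a) \<F>"
    using num_above_ratio[of y] assms(1) by (cases "y = 0") auto
  have "((\<lambda>i. real c / real (k i)) \<longlongrightarrow> 0) \<F>"
    by (rule real_tendsto_divide_at_top[OF tendsto_const k_real_at_top])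
  from tendsto_diff[OF tendsto_diff[OF num_above_ratio[of z] lim] this]
  have "((\<lambda>i. real (num_above i z) / real (k i) - (if y = 0 then 0 else real (num_above i y)) / real (k i)
      - real c / real (k i)) \<longlongrightarrow> z powr a - y powr a) \<F>"
    using assms by simp
  moreover have "0 < z powr a - y powr a"
    using assms a_pos by (simp add: powr_less_mono2)
  ultimately have "\<forall>\<^sub>F i in \<F>. 0 < real (num_above i z) / real (k i)
      - (if y = 0 then 0 else real (num_above i y)) / real (k i) - real c / real (k i)"
    by (rule order_tendstoD(1))
  with k_pos show ?thesis
  proof eventually_elim
    case (elim i)
    then have "0 < (real (num_above i z) - (if y = 0 then 0 else real (num_above i y)) - real c) / real (k i)"
      by (simp add: diff_divide_distrib)
    then have "0 < real (num_above i z) - (if y = 0 then 0 else real (num_above i y)) - real c"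
      using elim(1) by (simp add: zero_less_divide_iff)
    then show ?case by (auto split: if_splits)
  qed
qed

lemma num_above_ge_k: "1 < y \<Longrightarrow> \<forall>\<^sub>F i in \<F>. k i \<le> num_above i y"
proof -
  assume y: "1 < y"
  then have "1 < y powr a" using a_pos by simp
  then have "\<forall>\<^sub>F i in \<F>. 1 < real (num_above i y) / real (k i)"
    using order_tendstoD(1)[OF num_above_ratio[of y]] y by simp
  with k_pos show ?thesis
    by eventually_elim (simp add: less_divide_eq)
qed

lemma num_above_less_k: "0 < y \<Longrightarrow> y < 1 \<Longrightarrow> \<forall>\<^sub>F i in \<F>. num_above i y < k i"
proof -
  assume y: "0 < y" "y < 1"
  then have "y powr a < 1" using a_pos powr_less_mono2[of a y 1] by simp
  then have "\<forall>\<^sub>F i in \<F>. real (num_above i y) / real (k i) < 1"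
    using order_tendstoD(2)[OF num_above_ratio[of y]] y by simp
  with k_pos show ?thesis
    by eventually_elim (simp add: divide_less_eq)
qed

lemma gap_1_tendsto: "((\<lambda>i. gap i 1) \<longlongrightarrow> 0) \<F>"
proof (rule order_tendstoI)
  fix c :: real assume "c < 0"
  show "\<forall>\<^sub>F i in \<F>. c < gap i 1"
    using s_pos le_endpoint k_pos k_le_n
  proof eventually_elim
    case (elim i)
    then show ?case using gap_nonneg[of i 1] \<open>c < 0\<close> by simp
  qed
next
  fix c :: real assume c: "0 < c"
  show "\<forall>\<^sub>F i in \<F>. gap i 1 < c"
    using s_pos k_pos k_le_n num_above_diff_at_top[OF order_refl c, of 1]
  proof eventually_elim
    case (elim i)
    then show ?case using gap_less_iff[of i 1 c] by simp
  qed
qed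

lemma gap_k_tendsto: "((\<lambda>i. gap i (k i)) \<longlongrightarrow> 1) \<F>"
proof (rule order_tendstoI)
  fix c :: real assume "c < 1"
  define c' where "c' = (1 + max c 0) / 2"
  have c': "0 < c'" "c' < 1" "c < c'" using \<open>c < 1\<close> by (auto simp: c'_def max_def)
  show "\<forall>\<^sub>F i in \<F>. c < gap i (k i)"
    using s_pos k_pos k_le_n num_above_less_k[OF c'(1,2)]
  proof eventually_elim
    case (elim i)
    then have "\<not> gap i (k i) < c'" using gap_less_iff[of i "k i" c'] by simp
    then show ?case using c'(3) by linarith
  qed
next
  fix c :: real assume c: "1 < c"
  show "\<forall>\<^sub>F i in \<F>. gap i (k i) < c"
    using s_pos k_pos k_le_n num_above_ge_k[OF c]
  proof eventually_elim
    case (elim i)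
    then show ?case using gap_less_iff[of i "k i" c] by simp
  qed
qed

lemma excess_uniform: "uniform_limit {0..R} excess (\<lambda>y. y / (a + 1)) \<F>"
proof -
  have eq: "(e - x i j) / s i < y \<longleftrightarrow> x i j > e - s i * y" if "0 < s i" for i j y
    using that by (simp add: pos_divide_less_eq algebra_simps)
  have "uniform_limit {0..R}
    (\<lambda>i y. (\<Sum>j=1..n i. max 0 (y - (e - x i j) / s i)) / real (card {j\<in>{1..n i}. (e - x i j) / s i < y}))
    (\<lambda>y. y / (a + 1)) \<F>"
  proof (rule mean_excess_uniform_limit[OF a_pos k_pos])
    show "\<forall>\<^sub>F i in \<F>. \<forall>j\<in>{1..n i}. 0 \<le> (e - x i j) / s i"
      using s_pos le_endpoint by eventually_elim auto
    fix y :: real assume "0 < y"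
    have "\<forall>\<^sub>F i in \<F>. real (num_above i y) / real (k i)
        = real (card {j\<in>{1..n i}. (e - x i j) / s i < y}) / real (k i)"
      using s_pos by eventually_elim (simp add: num_above_def eq)
    from tendsto_cong[OF this] num_above_ratio[OF \<open>0 < y\<close>]
    show "((\<lambda>i. real (card {j\<in>{1..n i}. (e - x i j) / s i < y}) / real (k i)) \<longlongrightarrow> y powr a) \<F>"
      by simp
  qed
  moreover have "\<forall>\<^sub>F i in \<F>. \<forall>y\<in>{0..R}. excess i y =
      (\<Sum>j=1..n i. max 0 (y - (e - x i j) / s i)) / real (card {j\<in>{1..n i}. (e - x i j) / s i < y})"
    using s_pos by eventually_elim (simp add: excess_def emp_mean_excess_affine)
  ultimately show ?thesis
    using uniform_limit_cong by (smt (verit, best) eventually_mono)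
qed

definition plot_point :: "'i \<Rightarrow> nat \<Rightarrow> real \<times> real" where
  "plot_point i l = ((gap i (k i) - gap i l) / (gap i (k i) - gap i 1),
     excess i (gap i l) / (gap i (k i) - gap i 1))"

lemma me_plot_set_eq_plot_points:
  assumes "0 < s i"
  shows "me_plot_set (x i) (n i) (k i) = plot_point i ` {2..k i}"
proof -
  have os: "order_stat (x i) (n i) l = e - s i * gap i l" for l
    using assms by (simp add: gap_def)
  have "order_stat (x i) (n i) l - order_stat (x i) (n i) m = s i * (gap i m - gap i l)" for l m
    unfolding os by (simp add: algebra_simps)
  moreover have "emp_mean_excess (x i) (n i) (order_stat (x i) (n i) l) = s i * excess i (gap i l)" for l
    unfolding os excess_def using assms by simp
  ultimately show ?thesis
    unfolding me_plot_set_eq_image plot_point_def using assms by simp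
qed

text \<open>With \<open>w = gap i (k i) - gap i 1\<close>, which tends to \<open>1\<close>, a point of the plot with distance \<open>y\<close>
  has abscissa \<open>t\<close> such that \<open>1 - t = (y - gap i 1) / w\<close>, and ordinate about \<open>y / (a + 1) / w\<close>. The
  two differ from the relation on the segment only through \<open>gap i 1\<close>, which tends to \<open>0\<close>.\<close>

lemma plot_points_near_segment:
  assumes "0 < \<epsilon>"
  shows "\<forall>\<^sub>F i in \<F>. \<forall>l\<in>{2..k i}. fst (plot_point i l) \<in> {0..1} \<and>
    \<bar>snd (plot_point i l) - (1 - fst (plot_point i l)) / (a + 1)\<bar> < \<epsilon>"
proof -
  have "\<forall>\<^sub>F i in \<F>. \<forall>y\<in>{0..2}. dist (excess i y) (y / (a + 1)) < \<epsilon> / 4"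
    using excess_uniform by (rule uniform_limitD) (use assms in simp)
  moreover have "\<forall>\<^sub>F i in \<F>. gap i 1 < min (1 / 4) (\<epsilon> / 4)"
    using assms by (intro order_tendstoD(2)[OF gap_1_tendsto]) auto
  moreover have "\<forall>\<^sub>F i in \<F>. 3 / 4 < gap i (k i)" "\<forall>\<^sub>F i in \<F>. gap i (k i) < 2"
    by (rule order_tendstoD[OF gap_k_tendsto]; simp)+
  ultimately show ?thesis
    using s_pos k_le_n le_endpoint
  proof eventually_elim
    case (elim i)
    show ?case
    proof
      fix l assume l: "l \<in> {2..k i}"
      define w where "w = gap i (k i) - gap i 1"
      define y where "y = gap i l"
      have w: "1 / 2 < w" using elim by (simp add: w_def)
      have y: "gap i 1 \<le> y" "y \<le> gap i (k i)"
        unfolding y_def using l elim by (auto intro!: gap_mono)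
      have g1: "0 \<le> gap i 1" using gap_nonneg[of i 1] elim l by auto
      have t: "fst (plot_point i l) = (gap i (k i) - y) / w" "snd (plot_point i l) = excess i y / w"
        by (simp_all add: plot_point_def y_def w_def)
      have complement: "1 - (gap i (k i) - y) / w = (y - gap i 1) / w"
        using w by (simp add: field_simps w_def)
      have "(1 - fst (plot_point i l)) / (a + 1) = (y / (a + 1) - gap i 1 / (a + 1)) / w"
        unfolding t complement by (simp add: diff_divide_distrib mult.commute)
      then have "snd (plot_point i l) - (1 - fst (plot_point i l)) / (a + 1)
          = (excess i y - y / (a + 1) + gap i 1 / (a + 1)) / w"
        unfolding t(2) by (simp add: diff_divide_distrib add_divide_distrib)
      moreover have "\<bar>excess i y - y / (a + 1) + gap i 1 / (a + 1)\<bar> < \<epsilon> * w"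
      proof -
        have "\<bar>excess i y - y / (a + 1)\<bar> < \<epsilon> / 4"
          using elim(1) y g1 elim(4) by (auto simp: dist_real_def)
        moreover have "\<bar>gap i 1 / (a + 1)\<bar> \<le> gap i 1"
          using g1 a_pos by (simp add: divide_le_eq mult_le_cancel_left1 algebra_simps)
        moreover have "\<epsilon> * (1 / 2) < \<epsilon> * w"
          using w assms by (intro mult_strict_left_mono)
        ultimately show ?thesis using elim(2) by linarith
      qed
      ultimately have "\<bar>snd (plot_point i l) - (1 - fst (plot_point i l)) / (a + 1)\<bar> < \<epsilon>"
        using w by (simp add: abs_divide pos_divide_less_eq)
      moreover have "fst (plot_point i l) \<in> {0..1}"
        using y w unfolding t by (auto simp: w_def divide_le_eq)
      ultimately show "fst (plot_point i l) \<in> {0..1} \<and>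
        \<bar>snd (plot_point i l) - (1 - fst (plot_point i l)) / (a + 1)\<bar> < \<epsilon>" by simp
    qed
  qed
qed

text \<open>The number of distances below \<open>1 - t + \<eta>\<close> eventually exceeds the number below \<open>1 - t - \<eta>\<close>, so
  some order statistic has its distance in between.\<close>

lemma plot_points_dense:
  assumes t: "0 < t" "t < 1" and "0 < \<epsilon>"
  shows "\<forall>\<^sub>F i in \<F>. \<exists>l\<in>{2..k i}. \<bar>fst (plot_point i l) - t\<bar> < \<epsilon>"
proof -
  define \<eta> where "\<eta> = min (\<epsilon> / 4) (min t (1 - t) / 2)"
  have \<eta>: "0 < \<eta>" "\<eta> \<le> \<epsilon> / 4" "\<eta> < t" "\<eta> < 1 - t" "\<eta> \<le> 1 / 4" using assms by (auto simp: \<eta>_def min_def)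
  define y where "y = 1 - t"
  have y: "0 < y - \<eta>" "y + \<eta> < 1" using \<eta> by (auto simp: y_def)
  have "\<forall>\<^sub>F i in \<F>. 0 + 1 \<le> num_above i (y - \<eta>)"
    using num_above_diff_at_top[OF order_refl y(1), of 1] by simp
  moreover have "\<forall>\<^sub>F i in \<F>. num_above i (y - \<eta>) + 1 \<le> num_above i (y + \<eta>)"
    using num_above_diff_at_top[of "y - \<eta>" "y + \<eta>" 1] y \<eta>(1) by simp
  moreover have "\<forall>\<^sub>F i in \<F>. num_above i (y + \<eta>) < k i"
    using num_above_less_k[of "y + \<eta>"] y \<eta>(1) by simp
  moreover have "\<forall>\<^sub>F i in \<F>. gap i 1 < \<eta>"
    using \<eta>(1) by (intro order_tendstoD(2)[OF gap_1_tendsto]) auto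
  moreover have "\<forall>\<^sub>F i in \<F>. max (1 / 2) (1 - \<eta>) < gap i (k i)" "\<forall>\<^sub>F i in \<F>. gap i (k i) < 1 + \<eta>"
    by (rule order_tendstoD[OF gap_k_tendsto], use \<eta>(1) in simp)+
  ultimately show ?thesis
    using s_pos k_le_n le_endpoint plot_points_near_segment[OF zero_less_one]
  proof eventually_elim
    case (elim i)
    \<comment> \<open>The first order statistic whose distance is at least \<open>y - \<eta>\<close>.\<close>
    define l where "l = num_above i (y - \<eta>) + 1"
    have l: "l \<in> {2..k i}" "l \<le> n i" using elim by (auto simp: l_def)
    have "\<not> gap i l < y - \<eta>" "gap i l < y + \<eta>"
      using gap_less_iff[of i l] elim l by (auto simp: l_def)
    then have gl: "\<bar>gap i l - y\<bar> \<le> \<eta>" by linarith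
    define f where "f = fst (plot_point i l)"
    define w where "w = gap i (k i) - gap i 1"
    have g1: "0 \<le> gap i 1" using gap_nonneg[of i 1] elim l by auto
    have f: "0 \<le> f" "f \<le> 1" using elim(10) l(1) by (auto simp: f_def)
    have w: "0 < w" "\<bar>1 - w\<bar> \<le> 2 * \<eta>"
      using elim g1 \<eta>(1,5) unfolding w_def by auto
    have "f * w = gap i (k i) - gap i l"
      using w(1) by (simp add: f_def plot_point_def w_def)
    then have "f - t = f * (1 - w) + (gap i (k i) - 1) - (gap i l - y)"
      by (simp add: y_def algebra_simps)
    moreover have "\<bar>f * (1 - w)\<bar> \<le> 1 * (2 * \<eta>)"
      unfolding abs_mult using f w(2) by (intro mult_mono) auto
    moreover have "\<bar>gap i (k i) - 1\<bar> < \<eta>" using elim(5,6) by auto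
    ultimately have "\<bar>f - t\<bar> < \<epsilon>"
      using gl \<eta>(2) by linarith
    then show ?case using l(1) by (auto simp: f_def)
  qed
qed

lemma me_plot_near_segment:
  assumes "0 < \<epsilon>"
  shows "\<forall>\<^sub>F i in \<F>. \<forall>p\<in>me_plot_set (x i) (n i) (k i).
    \<exists>t\<in>{0..1}. dist p (t, (1 - t) / (a + 1)) < \<epsilon>"
  using plot_points_near_segment[OF assms] s_pos
proof eventually_elim
  case (elim i)
  show ?case
    unfolding me_plot_set_eq_plot_points[OF elim(2)]
  proof
    fix p assume "p \<in> plot_point i ` {2..k i}"
    then obtain l where l: "l \<in> {2..k i}" "p = plot_point i l" by blast
    then have "fst (plot_point i l) \<in> {0..1}"
      "dist (plot_point i l) (fst (plot_point i l), (1 - fst (plot_point i l)) / (a + 1)) < \<epsilon>"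
      using elim(1) by (auto simp: dist_prod_def dist_real_def)
    then show "\<exists>t\<in>{0..1}. dist p (t, (1 - t) / (a + 1)) < \<epsilon>" using l(2) by blast
  qed
qed

text \<open>The previous lemma locates order statistics between two levels strictly inside \<open>(0, 1)\<close>, and there
  is no room for this at the end points of the segment. Therefore \<open>t\<close> is first moved slightly
  into the open interval.\<close>

lemma segment_near_me_plot:
  assumes t: "0 \<le> t" "t \<le> 1" and "0 < \<epsilon>"
  shows "\<forall>\<^sub>F i in \<F>. \<exists>p\<in>me_plot_set (x i) (n i) (k i). dist p (t, (1 - t) / (a + 1)) < \<epsilon>"
proof -
  define t' where "t' = min (max t (min (1 / 2) (\<epsilon> / 8))) (1 - min (1 / 2) (\<epsilon> / 8))"
  have t': "0 < t'" "t' < 1" "\<bar>t' - t\<bar> \<le> \<epsilon> / 8"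
    using assms by (auto simp: t'_def min_def max_def)
  have e8: "0 < \<epsilon> / 8" and e4: "0 < \<epsilon> / 4" using assms(3) by auto
  show ?thesis
    using plot_points_dense[OF t'(1,2) e8] plot_points_near_segment[OF e4] s_pos
  proof eventually_elim
    case (elim i)
    then obtain l where l: "l \<in> {2..k i}" "\<bar>fst (plot_point i l) - t'\<bar> < \<epsilon> / 8" by blast
    define f g where "f = fst (plot_point i l)" and "g = snd (plot_point i l)"
    have ft: "\<bar>f - t\<bar> < \<epsilon> / 4" using l(2) t'(3) unfolding f_def by linarith
    have "\<bar>g - (1 - f) / (a + 1)\<bar> < \<epsilon> / 4"
      using elim(2) l(1) by (simp add: f_def g_def)
    moreover have "(1 - f) / (a + 1) - (1 - t) / (a + 1) = (t - f) / (a + 1)"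
      by (simp add: diff_divide_distrib)
    moreover have "\<bar>(t - f) / (a + 1)\<bar> \<le> \<bar>t - f\<bar>"
      using a_pos by (simp add: abs_divide divide_le_eq mult_le_cancel_left1 algebra_simps)
    ultimately have "\<bar>f - t\<bar> + \<bar>g - (1 - t) / (a + 1)\<bar> < \<epsilon>"
      using ft assms(3) by linarith
    moreover have "dist (plot_point i l) (t, (1 - t) / (a + 1)) \<le> \<bar>f - t\<bar> + \<bar>g - (1 - t) / (a + 1)\<bar>"
      unfolding dist_prod_def dist_real_def f_def g_def fst_conv snd_conv power2_abs
      by (rule sqrt_sum_squares_le_sum_abs)
    ultimately show ?case
      unfolding me_plot_set_eq_plot_points[OF elim(3)] using l(1) by force
  qed
qed

end

section \<open>Convergence in probability as convergence along a filter\<close>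

text \<open>The filter of properties of pairs \<open>(n, \<omega>)\<close> that hold with probability tending to \<open>1\<close>. A
  property may fail on any subset of an exceptional event, which makes the family upward
  closed and hence a filter. Convergence in probability of real variables to a
  constant is convergence along this filter.\<close>

definition high_prob :: "'w measure \<Rightarrow> (nat \<times> 'w) filter" where
  "high_prob M = Abs_filter (\<lambda>P. \<exists>B. (\<forall>n. B n \<in> sets M) \<and> (\<lambda>n. measure M (B n)) \<longlonglongrightarrow> 0 \<and>
     (\<forall>n. \<forall>\<omega>\<in>space M - B n. P (n, \<omega>)))"

context prob_space
begin

lemma eventually_high_prob:
  "eventually P (high_prob M) \<longleftrightarrow>
    (\<exists>B. (\<forall>n. B n \<in> events) \<and> (\<lambda>n. prob (B n)) \<longlonglongrightarrow> 0 \<and> (\<forall>n. \<forall>\<omega>\<in>space M - B n. P (n, \<omega>)))"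
  unfolding high_prob_def
proof (rule eventually_Abs_filter, rule is_filter.intro)
  show "\<exists>B. (\<forall>n. B n \<in> events) \<and> (\<lambda>n. prob (B n)) \<longlonglongrightarrow> 0 \<and> (\<forall>n. \<forall>\<omega>\<in>space M - B n. True)"
    by (intro exI[of _ "\<lambda>_. {}"]) simp
next
  fix P Q :: "nat \<times> 'a \<Rightarrow> bool"
  assume "\<exists>B. (\<forall>n. B n \<in> events) \<and> (\<lambda>n. prob (B n)) \<longlonglongrightarrow> 0 \<and> (\<forall>n. \<forall>\<omega>\<in>space M - B n. P (n, \<omega>))"
    and "\<exists>B. (\<forall>n. B n \<in> events) \<and> (\<lambda>n. prob (B n)) \<longlonglongrightarrow> 0 \<and> (\<forall>n. \<forall>\<omega>\<in>space M - B n. Q (n, \<omega>))"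
  then obtain A B where A: "\<And>n. A n \<in> events" "(\<lambda>n. prob (A n)) \<longlonglongrightarrow> 0"
      "\<forall>n. \<forall>\<omega>\<in>space M - A n. P (n, \<omega>)"
    and B: "\<And>n. B n \<in> events" "(\<lambda>n. prob (B n)) \<longlonglongrightarrow> 0" "\<forall>n. \<forall>\<omega>\<in>space M - B n. Q (n, \<omega>)"
    by blast
  have "(\<lambda>n. prob (A n \<union> B n)) \<longlonglongrightarrow> 0"
  proof (rule tendsto_sandwich[OF _ _ tendsto_const])
    show "(\<lambda>n. prob (A n) + prob (B n)) \<longlonglongrightarrow> 0"
      using tendsto_add[OF A(2) B(2)] by simp
    show "\<forall>\<^sub>F n in sequentially. prob (A n \<union> B n) \<le> prob (A n) + prob (B n)"
      using A(1) B(1) by (intro always_eventually allI measure_Un_le)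
  qed simp
  then show "\<exists>B. (\<forall>n. B n \<in> events) \<and> (\<lambda>n. prob (B n)) \<longlonglongrightarrow> 0 \<and>
      (\<forall>n. \<forall>\<omega>\<in>space M - B n. P (n, \<omega>) \<and> Q (n, \<omega>))"
    using A B by (intro exI[of _ "\<lambda>n. A n \<union> B n"]) auto
next
  fix P Q :: "nat \<times> 'a \<Rightarrow> bool"
  assume "\<forall>x. P x \<longrightarrow> Q x"
    and "\<exists>B. (\<forall>n. B n \<in> events) \<and> (\<lambda>n. prob (B n)) \<longlonglongrightarrow> 0 \<and> (\<forall>n. \<forall>\<omega>\<in>space M - B n. P (n, \<omega>))"
  then show "\<exists>B. (\<forall>n. B n \<in> events) \<and> (\<lambda>n. prob (B n)) \<longlonglongrightarrow> 0 \<and> (\<forall>n. \<forall>\<omega>\<in>space M - B n. Q (n, \<omega>))"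
    by metis
qed

lemma eventually_high_probI:
  assumes "\<And>n. B n \<in> events" "(\<lambda>n. prob (B n)) \<longlonglongrightarrow> 0"
    "\<And>n \<omega>. \<omega> \<in> space M \<Longrightarrow> \<omega> \<notin> B n \<Longrightarrow> P (n, \<omega>)"
  shows "eventually P (high_prob M)"
  unfolding eventually_high_prob using assms by blast

text \<open>Statements about large \<open>n\<close> alone are transferred to the filter through this limit.\<close>

lemma filterlim_fst_high_prob: "filterlim fst sequentially (high_prob M)"
  unfolding filterlim_iff
proof (intro allI impI)
  fix P :: "nat \<Rightarrow> bool" assume P: "eventually P sequentially"
  show "\<forall>\<^sub>F x in high_prob M. P (fst x)"
  proof (rule eventually_high_probI[of "\<lambda>n. if P n then {} else space M"])
    show "(\<lambda>n. prob (if P n then {} else space M)) \<longlonglongrightarrow> 0"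
      using P by (intro tendsto_eventually) (elim eventually_mono, simp)
  qed (auto split: if_splits)
qed

lemma eventually_high_prob_AE:
  assumes "\<And>n. AE \<omega> in M. P (n, \<omega>)"
  shows "eventually P (high_prob M)"
proof -
  have "\<exists>B. B \<in> events \<and> prob B = 0 \<and> (\<forall>\<omega>\<in>space M - B. P (n, \<omega>))" for n
  proof -
    obtain N where "{\<omega>\<in>space M. \<not> P (n, \<omega>)} \<subseteq> N" "emeasure M N = 0" "N \<in> events"
      using AE_E[OF assms] by blast
    then show ?thesis by (intro exI[of _ N]) (auto simp: measure_def)
  qed
  then obtain B where "\<And>n. B n \<in> events" "\<And>n. prob (B n) = 0" "\<And>n. \<forall>\<omega>\<in>space M - B n. P (n, \<omega>)"
    by metis
  then show ?thesis by (intro eventually_high_probI[of B]) auto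
qed

lemma high_prob_imp_prob_tendsto_0:
  assumes "\<forall>\<^sub>F (n, \<omega>) in high_prob M. \<not> P n \<omega>"
  shows "(\<lambda>n. prob {\<omega>\<in>space M. P n \<omega>}) \<longlonglongrightarrow> 0"
proof -
  obtain B where B: "\<And>n. B n \<in> events" "(\<lambda>n. prob (B n)) \<longlonglongrightarrow> 0"
    "\<And>n \<omega>. \<omega> \<in> space M - B n \<Longrightarrow> \<not> P n \<omega>"
    using assms unfolding eventually_high_prob by auto
  show ?thesis
  proof (rule tendsto_sandwich[OF _ _ tendsto_const B(2)])
    show "\<forall>\<^sub>F n in sequentially. prob {\<omega>\<in>space M. P n \<omega>} \<le> prob (B n)"
      using B(1,3) by (intro always_eventually allI finite_measure_mono) blast+
  qed simp
qed

text \<open>The neighbourhoods of \<open>L\<close> that contain \<open>Y n \<omega>\<close> with probability tending to \<open>1\<close> are closed under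
  finite intersections and supersets; if they include the subbasic ones, they include the balls of
  any metric for the topology.\<close>

lemma conv_in_prob_fellI:
  fixes Y :: "nat \<Rightarrow> 'a \<Rightarrow> 'b::{heine_borel,second_countable_topology} set"
  assumes "closed L" and closed_Y: "\<And>n \<omega>. closed (Y n \<omega>)"
    and meas: "\<forall>\<^sub>F n in sequentially.
      Y n \<in> measurable M (sigma (topspace fell_topology) {U. openin fell_topology U})"
    and miss: "\<And>K. compact K \<Longrightarrow> L \<inter> K = {} \<Longrightarrow> \<forall>\<^sub>F (n, \<omega>) in high_prob M. Y n \<omega> \<inter> K = {}"
    and hit: "\<And>G. open G \<Longrightarrow> L \<inter> G \<noteq> {} \<Longrightarrow> \<forall>\<^sub>F (n, \<omega>) in high_prob M. Y n \<omega> \<inter> G \<noteq> {}"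
  shows "conv_in_prob M fell_topology Y L"
proof -
  have nbhd: "L \<in> U \<longrightarrow> (\<forall>\<^sub>F (n, \<omega>) in high_prob M. Y n \<omega> \<in> U)"
    if "generate_topology_on ({{F. closed F \<and> F \<inter> K = {}} | K. compact K} \<union>
      {{F. closed F \<and> F \<inter> G \<noteq> {}} | G. open G}) U" for U
    using that
  proof induction
    case Empty
    then show ?case by simp
  next
    case (Int U V)
    then show ?case by (auto simp: case_prod_unfold eventually_conj_iff)
  next
    case (UN \<U>)
    show ?case
    proof
      assume "L \<in> \<Union> \<U>"
      then obtain U where U: "U \<in> \<U>" "L \<in> U" by blast
      then have "\<forall>\<^sub>F (n, \<omega>) in high_prob M. Y n \<omega> \<in> U" using UN.IH by blast
      then show "\<forall>\<^sub>F (n, \<omega>) in high_prob M. Y n \<omega> \<in> \<Union> \<U>"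
        by (rule eventually_mono) (use U in auto)
    qed
  next
    case (Basis U)
    then consider K where "compact K" "U = {F. closed F \<and> F \<inter> K = {}}"
      | G where "open G" "U = {F. closed F \<and> F \<inter> G \<noteq> {}}"
      by blast
    then show ?case
    proof cases
      case 1
      then show ?thesis using miss[of K] by (simp add: closed_Y)
    next
      case 2
      then show ?thesis using hit[of G] by (simp add: closed_Y)
    qed
  qed
  obtain d where d: "Metric_space (Collect closed) d"
    "Metric_space.mtopology (Collect closed) d = (fell_topology :: 'b set topology)"
    by (rule fell_topology_metric)
  interpret Metric_space "Collect closed" d by (rule d(1))
  have "(\<lambda>n. prob {\<omega>\<in>space M. d (Y n \<omega>) L > \<epsilon>}) \<longlonglongrightarrow> 0" if "\<epsilon> > 0" for \<epsilon>
  proof (rule high_prob_imp_prob_tendsto_0)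
    have "openin fell_topology (mball L \<epsilon>)"
      using openin_mball[of L \<epsilon>] d(2) by simp
    moreover have "L \<in> mball L \<epsilon>" using \<open>closed L\<close> that by simp
    ultimately have "\<forall>\<^sub>F (n, \<omega>) in high_prob M. Y n \<omega> \<in> mball L \<epsilon>"
      using nbhd unfolding fell_topology_def openin_topology_generated_by_iff by blast
    then show "\<forall>\<^sub>F (n, \<omega>) in high_prob M. \<not> d (Y n \<omega>) L > \<epsilon>"
      by (rule eventually_mono) (auto simp: commute)
  qed
  then show ?thesis
    unfolding conv_in_prob_def topspace_fell_topology
    using meas \<open>closed L\<close> d by (auto simp: topspace_fell_topology)
qed

end

section \<open>Counts of exceedances of an independent sample\<close>

text \<open>Pairwise independence bounds the second moment of the count by \<open>m + m\<^sup>2\<close>, where \<open>m\<close> is its mean,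
  so its variance is at most \<open>m\<close>.\<close>

lemma (in prob_space) count_exceedances_Chebyshev:
  assumes indep: "indep_vars (\<lambda>_. borel) X J" and "finite J"
    and p: "\<And>j. j \<in> J \<Longrightarrow> prob {\<omega>\<in>space M. X j \<omega> > (u::real)} = p" and "0 < c"
  shows "prob {\<omega>\<in>space M. c \<le> \<bar>real (card {j\<in>J. X j \<omega> > u}) - real (card J) * p\<bar>}
    \<le> real (card J) * p / c\<^sup>2"
proof -
  have rv[measurable]: "X j \<in> borel_measurable M" if "j \<in> J" for j
    using indep that by (auto simp: indep_vars_def)
  define E where "E j = {\<omega>\<in>space M. X j \<omega> > u}" for j
  have E[measurable]: "E j \<in> events" if "j \<in> J" for j
    unfolding E_def using rv[OF that] by measurable
  define f :: "'a \<Rightarrow> real" where "f \<omega> = (\<Sum>j\<in>J. indicator (E j) \<omega>)" for \<omega>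
  have f_eq: "f \<omega> = real (card {j\<in>J. X j \<omega> > u})" if "\<omega> \<in> space M" for \<omega>
  proof -
    have "f \<omega> = (\<Sum>j\<in>J. if X j \<omega> > u then 1 else 0)"
      unfolding f_def E_def using that by (intro sum.cong) (auto simp: indicator_def)
    also have "\<dots> = real (card {j\<in>J. X j \<omega> > u})"
      using \<open>finite J\<close> by (simp flip: sum.inter_filter)
    finally show ?thesis .
  qed
  have f_meas[measurable]: "f \<in> borel_measurable M"
    unfolding f_def using E by measurable
  have int_E: "integrable M (indicator (E j) :: 'a \<Rightarrow> real)" if "j \<in> J" for j
    using E[OF that] by (simp add: integrable_indicator_iff less_top[symmetric])
  have "expectation f = (\<Sum>j\<in>J. prob (E j))"
    unfolding f_def using int_E E by (subst Bochner_Integration.integral_sum) auto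
  also have "\<dots> = real (card J) * p" using p by (simp add: E_def)
  finally have mean: "expectation f = real (card J) * p" .
  have sq: "(f \<omega>)\<^sup>2 = (\<Sum>i\<in>J. \<Sum>j\<in>J. indicator (E i \<inter> E j) \<omega>)" for \<omega>
    by (simp add: f_def power2_eq_square sum_product indicator_inter_arith)
  have int_EE: "integrable M (indicator (E i \<inter> E j) :: 'a \<Rightarrow> real)" if "i \<in> J" "j \<in> J" for i j
    using E[OF that(1)] E[OF that(2)] by (simp add: integrable_indicator_iff less_top[symmetric] sets.Int)
  have int_sq: "integrable M (\<lambda>\<omega>. (f \<omega>)\<^sup>2)"
    unfolding sq using int_EE by (intro Bochner_Integration.integrable_sum) auto
  have pair: "prob (E i \<inter> E j) = p\<^sup>2" if "i \<in> J" "j \<in> J" "i \<noteq> j" for i j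
  proof -
    have "prob (\<Inter>l\<in>{i, j}. X l -` {u<..} \<inter> space M) = (\<Prod>l\<in>{i, j}. prob (X l -` {u<..} \<inter> space M))"
      using that by (intro indep_varsD[OF indep]) auto
    moreover have "X l -` {u<..} \<inter> space M = E l" for l by (auto simp: E_def)
    ultimately show ?thesis using that p by (simp add: E_def power2_eq_square)
  qed
  have p01: "0 \<le> p" "p \<le> 1" if "J \<noteq> {}" using that p by (metis all_not_in_conv measure_nonneg, metis all_not_in_conv prob_le_1)
  have "expectation (\<lambda>\<omega>. (f \<omega>)\<^sup>2) = (\<Sum>i\<in>J. \<Sum>j\<in>J. prob (E i \<inter> E j))"
    unfolding sq using int_EE E
    by (simp add: Bochner_Integration.integral_sum Bochner_Integration.integrable_sum sets.Int)
  also have "\<dots> \<le> (\<Sum>i\<in>J. p + real (card J) * p\<^sup>2)"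
  proof (rule sum_mono)
    fix i assume i: "i \<in> J"
    have "(\<Sum>j\<in>J. prob (E i \<inter> E j)) = prob (E i) + (\<Sum>j\<in>J - {i}. prob (E i \<inter> E j))"
      using \<open>finite J\<close> i by (subst sum.remove[of J i]) auto
    also have "(\<Sum>j\<in>J - {i}. prob (E i \<inter> E j)) = (\<Sum>j\<in>J - {i}. p\<^sup>2)"
      using pair i by (intro sum.cong) auto
    also have "\<dots> \<le> real (card J) * p\<^sup>2"
      using \<open>finite J\<close> by (simp add: mult_right_mono card_Diff_subset_Int card_mono)
    finally show "(\<Sum>j\<in>J. prob (E i \<inter> E j)) \<le> p + real (card J) * p\<^sup>2"
      using p[OF i] by (simp add: E_def)
  qed
  finally have second: "expectation (\<lambda>\<omega>. (f \<omega>)\<^sup>2) \<le> real (card J) * p + (real (card J) * p)\<^sup>2"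
    by (simp add: distrib_left power2_eq_square mult_ac)
  have "variance f = expectation (\<lambda>\<omega>. (f \<omega>)\<^sup>2) - (expectation f)\<^sup>2"
    using int_sq by (intro variance_eq) (auto intro: square_integrable_imp_integrable)
  then have var: "variance f \<le> real (card J) * p" using second mean by simp
  have "prob {\<omega>\<in>space M. \<bar>f \<omega> - expectation f\<bar> \<ge> c} \<le> variance f / c\<^sup>2"
    using int_sq \<open>0 < c\<close> by (intro Chebyshev_inequality) auto
  also have "\<dots> \<le> real (card J) * p / c\<^sup>2"
    using var by (intro divide_right_mono) auto
  finally have "prob {\<omega>\<in>space M. \<bar>f \<omega> - real (card J) * p\<bar> \<ge> c} \<le> real (card J) * p / c\<^sup>2"
    unfolding mean .
  moreover have "{\<omega>\<in>space M. \<bar>f \<omega> - real (card J) * p\<bar> \<ge> c}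
      = {\<omega>\<in>space M. c \<le> \<bar>real (card {j\<in>J. X j \<omega> > u}) - real (card J) * p\<bar>}"
    using f_eq by auto
  ultimately show ?thesis by simp
qed

text \<open>The Chebyshev bound at the distance \<open>\<epsilon> / 2 * k n\<close> is of order \<open>n * q n / (k n)\<^sup>2\<close>, which tends to
  \<open>0\<close> because \<open>n * q n\<close> is at most of order \<open>k n\<close> and \<open>k n\<close> tends to infinity.\<close>

lemma (in prob_space) count_ratio_tendsto_high_prob:
  fixes X :: "nat \<Rightarrow> 'a \<Rightarrow> real" and u q :: "nat \<Rightarrow> real" and k :: "nat \<Rightarrow> nat"
  assumes indep: "indep_vars (\<lambda>_. borel) X {1..}"
    and q: "\<And>n j. 1 \<le> j \<Longrightarrow> prob {\<omega>\<in>space M. X j \<omega> > u n} = q n"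
    and k: "filterlim k at_top sequentially"
    and lim: "(\<lambda>n. real n * q n / real (k n)) \<longlonglongrightarrow> c"
  shows "((\<lambda>(n, \<omega>). real (card {j\<in>{1..n}. X j \<omega> > u n}) / real (k n)) \<longlongrightarrow> c) (high_prob M)"
proof (rule tendstoI)
  fix \<epsilon> :: real assume \<epsilon>: "0 < \<epsilon>"
  have rv[measurable]: "X j \<in> borel_measurable M" if "1 \<le> j" for j
    using indep that by (auto simp: indep_vars_def)
  define B where "B n = {\<omega>\<in>space M. \<epsilon> / 2 * real (k n)
    \<le> \<bar>real (card {j\<in>{1..n}. X j \<omega> > u n}) - real (card {1..n}) * q n\<bar>}" for n
  have B_sets: "B n \<in> events" for n
  proof -
    have "real (card {j\<in>{1..n}. X j \<omega> > u n}) = (\<Sum>j\<in>{1..n}. if X j \<omega> > u n then 1 else 0)" for \<omega>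
      by (simp flip: sum.inter_filter)
    then show ?thesis
      unfolding B_def using rv by (simp only:) measurable
  qed
  have k_pos: "\<forall>\<^sub>F n in sequentially. 0 < k n"
    using eventually_compose_filterlim[OF eventually_gt_at_top k] .
  have "(\<lambda>n. prob (B n)) \<longlonglongrightarrow> 0"
  proof (rule tendsto_sandwich[OF _ _ tendsto_const])
    have "filterlim (\<lambda>n. real (k n)) at_top sequentially"
      by (rule filterlim_compose[OF filterlim_real_sequentially k])
    then have "(\<lambda>n. real n * q n / real (k n) * (4 / \<epsilon>\<^sup>2) / real (k n)) \<longlonglongrightarrow> 0"
      by (intro real_tendsto_divide_at_top[OF tendsto_mult[OF lim tendsto_const]])
    then show "(\<lambda>n. real n * q n / real (k n) * (4 / \<epsilon>\<^sup>2) / real (k n)) \<longlonglongrightarrow> 0" .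
    show "\<forall>\<^sub>F n in sequentially. prob (B n) \<le> real n * q n / real (k n) * (4 / \<epsilon>\<^sup>2) / real (k n)"
      using k_pos
    proof eventually_elim
      case (elim n)
      have "prob (B n) \<le> real (card {1..n}) * q n / (\<epsilon> / 2 * real (k n))\<^sup>2"
        unfolding B_def using q elim \<epsilon>
        by (intro count_exceedances_Chebyshev indep_vars_subset[OF indep]) auto
      also have "\<dots> = real n * q n / real (k n) * (4 / \<epsilon>\<^sup>2) / real (k n)"
        by (simp add: power2_eq_square field_simps)
      finally show ?case .
    qed
  qed simp
  then have "\<forall>\<^sub>F x in high_prob M. snd x \<notin> B (fst x)"
    using B_sets by (intro eventually_high_probI[of B]) auto
  moreover have "\<forall>\<^sub>F x in high_prob M. 0 < k (fst x) \<and> dist (real (fst x) * q (fst x) / real (k (fst x))) c < \<epsilon> / 2"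
    using eventually_compose_filterlim[OF eventually_conj[OF k_pos tendstoD[OF lim, of "\<epsilon> / 2"]] filterlim_fst_high_prob] \<epsilon>
    by simp
  moreover have "\<forall>\<^sub>F x in high_prob M. snd x \<in> space M"
    by (intro eventually_high_probI[of "\<lambda>_. {}"]) auto
  ultimately show "\<forall>\<^sub>F x in high_prob M.
      dist (case x of (n, \<omega>) \<Rightarrow> real (card {j\<in>{1..n}. X j \<omega> > u n}) / real (k n)) c < \<epsilon>"
  proof eventually_elim
    case (elim x)
    obtain n \<omega> where x: "x = (n, \<omega>)" by (cases x)
    define r where "r = real n * q n / real (k n)"
    define N where "N = real (card {j\<in>{1..n}. X j \<omega> > u n})"
    have kn: "0 < real (k n)" using elim by (simp add: x)
    have "\<bar>N - real n * q n\<bar> < \<epsilon> / 2 * real (k n)"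
      using elim unfolding x B_def N_def by auto
    then have "\<bar>(N - real n * q n) / real (k n)\<bar> < \<epsilon> / 2"
      using kn by (simp add: abs_divide pos_divide_less_eq)
    then have "\<bar>N / real (k n) - r\<bar> < \<epsilon> / 2"
      by (simp add: r_def diff_divide_distrib)
    moreover have "\<bar>r - c\<bar> < \<epsilon> / 2"
      using elim by (simp add: x r_def dist_real_def)
    ultimately have "\<bar>N / real (k n) - c\<bar> < \<epsilon>" by linarith
    then show ?case by (simp add: x N_def dist_real_def)
  qed
qed

section \<open>Convergence of the mean excess plot\<close>

theorem theorem3p7:
  fixes M :: "'w measure" and X :: "nat \<Rightarrow> 'w \<Rightarrow> real" and F :: "real \<Rightarrow> real"
    and \<xi> xF :: real and k :: "nat \<Rightarrow> nat"
  assumes "prob_space M"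
    and "\<xi> < 0"
    and "prob_space.indep_vars M (\<lambda>_. borel) X {1..}"
    and "\<And>n. n \<ge> 1 \<Longrightarrow> cdf (distr M borel (X n)) = F"
    and "right_endpoint F = ereal xF"
    and "regularly_varying (\<lambda>x. 1 - F (xF - 1 / x)) (1 / \<xi>)"
    and "\<And>n. n \<ge> 1 \<Longrightarrow> k n > 0"
    and "filterlim k at_top sequentially"
    and "(\<lambda>n. real (k n) / real n) \<longlonglongrightarrow> 0"
  shows "conv_in_prob M fell_topology
           (\<lambda>n \<omega>. me_plot_set (\<lambda>j. X j \<omega>) n (k n))
           {(t, \<xi> / (1 - \<xi>) * (t - 1)) | t. 0 \<le> t \<and> t \<le> 1}"
proof -
  interpret prob_space M by fact
  define a where "a = - (1 / \<xi>)"
  have a: "0 < a" using \<open>\<xi> < 0\<close> by (simp add: a_def)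
  have rv: "X j \<in> borel_measurable M" if "1 \<le> j" for j
    using assms(3) that by (auto simp: indep_vars_def)
  have tail: "prob {\<omega>\<in>space M. X j \<omega> > u} = 1 - F u" if "1 \<le> j" for j u
  proof -
    have "F u = prob {\<omega>\<in>space M. X j \<omega> \<le> u}"
      using assms(4)[OF that] rv[OF that]
      by (auto simp: cdf_def measure_distr vimage_def Int_def conj_commute fun_eq_iff)
    moreover have "{\<omega>\<in>space M. X j \<omega> > u} = space M - {\<omega>\<in>space M. X j \<omega> \<le> u}" by auto
    moreover have "{\<omega>\<in>space M. X j \<omega> \<le> u} \<in> events"
      using rv[OF that] by measurable
    ultimately show ?thesis by (simp add: prob_compl)
  qed
  have F_mono: "F u \<le> F v" if "u \<le> v" for u v
  proof -
    have "prob {\<omega>\<in>space M. X 1 \<omega> > v} \<le> prob {\<omega>\<in>space M. X 1 \<omega> > u}"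
      using rv[of 1] that by (intro finite_measure_mono) auto
    then show ?thesis by (simp add: tail)
  qed
  define G where "G s = 1 - F (xF - s)" for s
  have G_mono: "G s \<le> G t" if "0 < s" "s \<le> t" for s t
    using F_mono that by (simp add: G_def)
  have G_pos: "0 < G s" if "0 < s" for s
  proof -
    have "ereal (xF - s) < right_endpoint F" using assms(5) that by simp
    then obtain x where "F x < 1" "xF - s < x"
      unfolding right_endpoint_def less_SUP_iff by auto
    then show ?thesis using F_mono[of "xF - s" x] by (simp add: G_def)
  qed
  have G_rv: "((\<lambda>s. G (s * x) / G s) \<longlongrightarrow> x powr a) (at_right 0)" if "0 < x" for x
    unfolding G_def a_def by (rule regularly_varying_at_endpoint[OF assms(6) that])
  \<comment> \<open>A positive value would be a lower bound for \<open>G\<close>, which takes arbitrarily small values.\<close>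
  have "1 - F xF \<le> 0"
  proof (rule ccontr)
    assume "\<not> 1 - F xF \<le> 0"
    then obtain s where "0 < s" "G s < 1 - F xF"
      using regularly_varying_tendsto_0[of G "2 powr a" "1 - F xF"] G_mono G_pos G_rv[of 2] a by auto
    then show False using F_mono[of "xF - s" xF] by (simp add: G_def)
  qed
  then have null: "prob {\<omega>\<in>space M. X j \<omega> > xF} = 0" if "1 \<le> j" for j
    using tail[OF that, of xF] measure_nonneg[of M "{\<omega>\<in>space M. X j \<omega> > xF}"] by linarith
  have below: "AE \<omega> in M. X j \<omega> \<le> xF" if "1 \<le> j" for j
  proof (rule AE_I[of _ _ "{\<omega>\<in>space M. X j \<omega> > xF}"])
    show "emeasure M {\<omega>\<in>space M. X j \<omega> > xF} = 0"
      using null[OF that] by (simp add: emeasure_eq_measure)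
    show "{\<omega>\<in>space M. X j \<omega> > xF} \<in> events" using rv[OF that] by measurable
  qed auto
  have "\<forall>\<^sub>F n in sequentially. 0 < real (k n) / real n"
    using eventually_ge_at_top[of 1] by eventually_elim (simp add: assms(7))
  then obtain s where s_pos: "\<forall>\<^sub>F n in sequentially. 0 < s n"
    and s_lim: "\<And>y. 0 < y \<Longrightarrow> (\<lambda>n. G (s n * y) / (real (k n) / real n)) \<longlonglongrightarrow> y powr a"
    using regularly_varying_threshold[of G a "\<lambda>n. real (k n) / real n"] G_mono G_pos G_rv a assms(9) by blast
  have kn: "\<forall>\<^sub>F n in sequentially. k n \<le> n"
    using order_tendstoD(2)[OF assms(9) zero_less_one] eventually_ge_at_top[of 1]
    by eventually_elim (simp add: divide_less_eq)
  interpret top_order_array "\<lambda>x j. X j (snd x)" fst "\<lambda>x. k (fst x)" "\<lambda>x. s (fst x)" xF a "high_prob M"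
  proof
    show "filterlim (\<lambda>x. k (fst x)) at_top (high_prob M)"
      by (rule filterlim_compose[OF assms(8) filterlim_fst_high_prob])
    show "\<forall>\<^sub>F x in high_prob M. k (fst x) \<le> fst x" "\<forall>\<^sub>F x in high_prob M. 0 < s (fst x)"
      by (rule eventually_compose_filterlim[OF kn filterlim_fst_high_prob],
          rule eventually_compose_filterlim[OF s_pos filterlim_fst_high_prob])
    show "\<forall>\<^sub>F x in high_prob M. \<forall>j\<in>{1..fst x}. X j (snd x) \<le> xF"
    proof (rule eventually_high_prob_AE)
      fix n
      show "AE \<omega> in M. \<forall>j\<in>{1..fst (n, \<omega>)}. X j (snd (n, \<omega>)) \<le> xF"
        unfolding fst_conv snd_conv by (rule AE_finite_allI) (auto intro: below)
    qed
    fix y :: real assume "0 < y"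
    have "((\<lambda>(n, \<omega>). real (card {j\<in>{1..n}. X j \<omega> > xF - s n * y}) / real (k n)) \<longlongrightarrow> y powr a) (high_prob M)"
    proof (rule count_ratio_tendsto_high_prob[OF assms(3) _ assms(8)])
      show "prob {\<omega>\<in>space M. X j \<omega> > xF - s n * y} = G (s n * y)" if "1 \<le> j" for n j
        using tail[OF that] by (simp add: G_def)
      show "(\<lambda>n. real n * G (s n * y) / real (k n)) \<longlonglongrightarrow> y powr a"
        using s_lim[OF \<open>0 < y\<close>] by (simp add: mult.commute)
    qed
    then show "((\<lambda>x. real (card {j\<in>{1..fst x}. X j (snd x) > xF - s (fst x) * y}) / real (k (fst x)))
        \<longlongrightarrow> y powr a) (high_prob M)"
      by (simp add: case_prod_unfold)
  qed (rule a)
  have slope: "\<xi> / (1 - \<xi>) * (t - 1) = (1 - t) / (a + 1)" for t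
    using \<open>\<xi> < 0\<close> by (simp add: a_def field_simps)
  define L where "L = (\<lambda>t::real. (t, (1 - t) / (a + 1))) ` {0..1}"
  have L: "{(t, \<xi> / (1 - \<xi>) * (t - 1)) | t. 0 \<le> t \<and> t \<le> 1} = L"
    unfolding L_def slope by auto
  have "closed L"
    unfolding L_def using a
    by (intro compact_imp_closed compact_continuous_image continuous_intros) auto
  have "conv_in_prob M fell_topology (\<lambda>n \<omega>. me_plot_set (\<lambda>j. X j \<omega>) n (k n)) L"
  proof (rule conv_in_prob_fellI[OF \<open>closed L\<close>])
    show "closed (me_plot_set (\<lambda>j. X j \<omega>) n (k n))" for n \<omega>
      by (rule finite_imp_closed[OF finite_me_plot_set])
    show "\<forall>\<^sub>F n in sequentially. (\<lambda>\<omega>. me_plot_set (\<lambda>j. X j \<omega>) n (k n))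
        \<in> measurable M (sigma (topspace fell_topology) {U. openin fell_topology U})"
      using kn by eventually_elim (rule measurable_me_plot_set, use rv in auto)
  next
    fix K :: "(real \<times> real) set" assume K: "compact K" "L \<inter> K = {}"
    then obtain \<delta> where \<delta>: "0 < \<delta>" "\<And>x y. x \<in> K \<Longrightarrow> y \<in> L \<Longrightarrow> \<delta> \<le> dist x y"
      using separate_compact_closed[OF K(1) \<open>closed L\<close>] by blast
    show "\<forall>\<^sub>F (n, \<omega>) in high_prob M. me_plot_set (\<lambda>j. X j \<omega>) n (k n) \<inter> K = {}"
      unfolding case_prod_unfold using me_plot_near_segment[OF \<delta>(1)]
    proof eventually_elim
      case (elim x)
      then show ?case using \<delta>(2) unfolding L_def by fastforce
    qed
  next
    fix G :: "(real \<times> real) set" assume G: "open G" "L \<inter> G \<noteq> {}"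
    then obtain t where t: "0 \<le> t" "t \<le> 1" "(t, (1 - t) / (a + 1)) \<in> G"
      unfolding L_def by auto
    then obtain \<delta> where \<delta>: "0 < \<delta>" "\<And>p. dist p (t, (1 - t) / (a + 1)) < \<delta> \<Longrightarrow> p \<in> G"
      using G(1) unfolding open_dist by blast
    show "\<forall>\<^sub>F (n, \<omega>) in high_prob M. me_plot_set (\<lambda>j. X j \<omega>) n (k n) \<inter> G \<noteq> {}"
      unfolding case_prod_unfold using segment_near_me_plot[OF t(1,2) \<delta>(1)]
    proof eventually_elim
      case (elim x)
      then show ?case using \<delta>(2) by blast
    qed
  qed
  then show ?thesis unfolding L .
qed

end
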